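(* Let $(M_i)_{i\in\mathbb{N}}$ be a sequence of positive integers and $(\alpha_i)_{i\in\mathbb{N}}$ a sequence of positive reals with $\alpha_i>2^{M_{i+1}}\alpha_{i+1}$ for each $i\in\mathbb{N}$, and let $E:=E(\alpha_i,2^{M_i}-1)$ (which is a Central Cantor set). Then: (1) the number of semi-fast convergent representations of $E$ is equal to the continuum $\mathfrak{c}$ if and only if infinitely many of the $M_i$ are greater than $1$; (2) if $M_i=1$ for all but finitely many $i$, then the number of semi-fast convergent representations of $E$ is equal to $\prod_{i=1}^{\infty}2^{M_i-1}$.
   Context: All sequences $(x_n)_{n\in\mathbb{N}}$ considered are infinite, non-increasing, summable sequences of positive real numbers. The achievement set of $(x_n)$ is $E(x_n)=\{\sum_{n\in A}x_n : A\subset\mathbb{N}\}$; a representation of a set $E$ is any such sequence $(x_n)$ with $E(x_n)=E$. A sequence $(x_n)$ is semi-fast convergent if $x_n>\sum_{k:\,x_k<x_n}x_k$ for every $n$. For a strictly decreasing sequence $(\alpha_k)$ of positive reals tending to $0$ and positive integers $N_k$, $(\alpha_k,N_k)$ denotes the sequence $(\underbrace{\alpha_1,\ldots,\alpha_1}_{N_1},\underbrace{\alpha_2,\ldots,\alpha_2}_{N_2},\ldots)$ and $E(\alpha_k,N_k)$ its achievement set; this sequence is semi-fast convergent iff $\alpha_k>\sum_{n>k}N_n\alpha_n$ for each $k$. (The inequality assumed in the claim implies this condition for $N_k=2^{M_k}-1$.) A Central Cantor set here is, equivalently, an achievement set that has a fast convergent representation, i.e. a representation $(x_n)$ with $x_n>\sum_{i>n}x_i$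 for all $n$. *)

theory Defs
  imports "HOL-Analysis.Analysis" "HOL-Library.Equipollence"
begin

definition achievement_set :: "(nat \<Rightarrow> real) \<Rightarrow> real set" where
  "achievement_set x = {(\<Sum>\<^sub>\<infinity>n\<in>A. x n) | A. True}"

definition is_representation :: "(nat \<Rightarrow> real) \<Rightarrow> real set \<Rightarrow> bool" where
  "is_representation x E \<longleftrightarrow>
     (\<forall>n. 0 < x n) \<and> decseq x \<and> summable x \<and> achievement_set x = E"

text \<open>
  The unordered sums below are \<open>0\<close> by convention when the terms are not summable, so these
  two predicates are meaningful only for summable sequences; they are used only for
  representations.
\<close>

definition semi_fast_convergent :: "(nat \<Rightarrow> real) \<Rightarrow> bool" where
  "semi_fast_convergent x \<longleftrightarrow> (\<forall>n. (\<Sum>\<^sub>\<infinity>k\<in>{k. x k < x n}. x k) < x n)"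

definition fast_convergent :: "(nat \<Rightarrow> real) \<Rightarrow> bool" where
  "fast_convergent x \<longleftrightarrow> (\<forall>n. (\<Sum>\<^sub>\<infinity>i\<in>{n<..}. x i) < x n)"

definition central_cantor_set :: "real set \<Rightarrow> bool" where
  "central_cantor_set E \<longleftrightarrow> (\<exists>x. is_representation x E \<and> fast_convergent x)"

definition semi_fast_representations :: "real set \<Rightarrow> (nat \<Rightarrow> real) set" where
  "semi_fast_representations E = {x. is_representation x E \<and> semi_fast_convergent x}"

text \<open>
  The sequence \<open>(\<alpha> 0, \<dots>, \<alpha> 0, \<alpha> 1, \<dots>, \<alpha> 1, \<dots>)\<close> in which \<open>\<alpha> k\<close> is listed \<open>N k\<close> times:
  position \<open>n\<close> lies in the first block \<open>k\<close> whose end \<open>N 0 + \<dots> + N k\<close> exceeds \<open>n\<close>.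
  All \<open>N k\<close> are meant to be positive.
\<close>

definition block_seq :: "(nat \<Rightarrow> real) \<Rightarrow> (nat \<Rightarrow> nat) \<Rightarrow> nat \<Rightarrow> real" where
  "block_seq \<alpha> N n = \<alpha> (LEAST k. n < (\<Sum>i\<le>k. N i))"

lemma block_seq_eq:
  assumes "j < N k"
  shows "block_seq \<alpha> N ((\<Sum>i<k. N i) + j) = \<alpha> k"
proof -
  have "(LEAST l. (\<Sum>i<k. N i) + j < (\<Sum>i\<le>l. N i)) = k"
  proof (rule Least_equality)
    show "(\<Sum>i<k. N i) + j < (\<Sum>i\<le>k. N i)"
      using assms by (simp add: lessThan_Suc_atMost[symmetric])
  next
    fix l assume l: "(\<Sum>i<k. N i) + j < (\<Sum>i\<le>l. N i)"
    show "k \<le> l"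
    proof (rule ccontr)
      assume "\<not> k \<le> l"
      then have "(\<Sum>i\<le>l. N i) \<le> (\<Sum>i<k. N i)"
        by (intro sum_mono2) auto
      with l show False by simp
    qed
  qed
  then show ?thesis by (simp add: block_seq_def)
qed

end

(*
  Replacing each block of 2^M - 1 copies of \<alpha> by 2^(M-1) \<alpha>, ..., 2 \<alpha>, \<alpha> turns the given sequence into
  a fast convergent sequence y with the same achievement set E.  If x is a semi-fast representation
  of E starting with exactly c copies of \<beta>, then c is odd: E is symmetric, and for even c a comparison
  of the two halves of E shows that the tail of y starting at y 1 has the same shape with \<beta> halved, so
  that y would be geometric with ratio 1/2, which is not fast convergent.  For c = 2 h + 1 the gap around
  the centre of E gives y 0 = (h + 1) \<beta>, and after deleting h + 1 copies of \<beta> from x and y 0 from y the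
  argument repeats.  Hence c + 1 is a power of 2, and x arises from y by merging runs of
  consecutive terms with ratio 2.  Every such merging is a semi-fast representation, so these
  correspond to the subsets of R = {n. y n = 2 y (n+1)}, which has M i - 1 elements in the i-th block.
*)
theory Submission
  imports Defs
begin

section \<open>Achievement sets as sets of subsums: bounds, symmetry and recursion\<close>

lemma sums_infsum_restrict:
  fixes x :: "nat \<Rightarrow> real"
  assumes "\<And>n. 0 \<le> x n" "summable x"
  shows "(\<lambda>n. if n \<in> A then x n else 0) sums infsum x A"
proof -
  have "x summable_on UNIV"
    using assms by (simp add: summable_on_UNIV_nonneg_real_iff)
  then have "x summable_on A"
    by (rule summable_on_subset_banach) simp
  then have "(x has_sum infsum x A) A"
    by (rule has_sum_infsum)
  then have "((\<lambda>n. if n \<in> A then x n else 0) has_sum infsum x A) UNIV"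
    by (subst has_sum_cong_neutral[where T = A and g = x]) auto
  then show ?thesis
    by (rule has_sum_imp_sums)
qed

lemma achievement_set_iff:
  fixes x :: "nat \<Rightarrow> real"
  assumes "\<And>n. 0 \<le> x n" "summable x"
  shows "e \<in> achievement_set x \<longleftrightarrow> (\<exists>A. (\<lambda>n. if n \<in> A then x n else 0) sums e)"
  using sums_infsum_restrict[OF assms] unfolding achievement_set_def
  by (auto dest: sums_unique2)

lemma infsum_greaterThan_eq_suminf:
  fixes x :: "nat \<Rightarrow> real"
  assumes "\<And>n. 0 \<le> x n" "summable x"
  shows "infsum x {n<..} = (\<Sum>i. x (i + Suc n))"
proof -
  have "(\<lambda>i. if i + Suc n \<in> {n<..} then x (i + Suc n) else 0) sums infsum x {n<..}"
    using sums_infsum_restrict[OF assms, of "{n<..}"]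
      sums_iff_shift[of "\<lambda>i. if i \<in> {n<..} then x i else 0" "Suc n" "infsum x {n<..}"]
    by (simp add: sum.neutral)
  then show ?thesis
    by (simp add: sums_iff)
qed

lemma achievement_set_bounds:
  fixes x :: "nat \<Rightarrow> real"
  assumes "\<And>n. 0 \<le> x n" "summable x" "e \<in> achievement_set x"
  shows "0 \<le> e" "e \<le> suminf x"
proof -
  obtain A where A: "(\<lambda>n. if n \<in> A then x n else 0) sums e"
    using achievement_set_iff[OF assms(1,2)] assms(3) by blast
  show "0 \<le> e"
    by (rule sums_le[OF _ sums_zero A]) (use assms in auto)
  show "e \<le> suminf x"
    by (rule sums_le[OF _ A summable_sums]) (use assms in auto)
qed

text \<open>Complementing the index set reflects a subsum. This symmetry later enters
  \<open>layered\<close>.\<close>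

lemma achievement_set_reflect:
  fixes x :: "nat \<Rightarrow> real"
  assumes "\<And>n. 0 \<le> x n" "summable x" "e \<in> achievement_set x"
  shows "suminf x - e \<in> achievement_set x"
proof -
  obtain A where A: "(\<lambda>n. if n \<in> A then x n else 0) sums e"
    using achievement_set_iff[OF assms(1,2)] assms(3) by blast
  have "(\<lambda>n. x n - (if n \<in> A then x n else 0)) sums (suminf x - e)"
    by (intro sums_diff A summable_sums assms)
  also have "(\<lambda>n. x n - (if n \<in> A then x n else 0)) = (\<lambda>n. if n \<in> -A then x n else 0)"
    by auto
  finally show ?thesis
    using achievement_set_iff[OF assms(1,2)] by blast
qed

lemma zero_in_achievement_set: "0 \<in> achievement_set x"
  unfolding achievement_set_def by (auto intro: exI[of _ "{}"])

lemma suminf_in_achievement_set: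
  fixes x :: "nat \<Rightarrow> real"
  assumes "\<And>n. 0 \<le> x n" "summable x"
  shows "suminf x \<in> achievement_set x"
  using achievement_set_reflect[OF assms zero_in_achievement_set] by simp

lemma achievement_set_Suc:
  fixes x :: "nat \<Rightarrow> real"
  assumes "\<And>n. 0 \<le> x n" "summable x"
  shows "e \<in> achievement_set x \<longleftrightarrow>
    e \<in> achievement_set (\<lambda>i. x (Suc i)) \<or> e - x 0 \<in> achievement_set (\<lambda>i. x (Suc i))"
proof -
  have sm: "summable (\<lambda>i. x (Suc i))"
    using assms by (simp add: summable_Suc_iff)
  note iff' = achievement_set_iff[where x = "\<lambda>i. x (Suc i)", OF assms(1) sm]
  have shift: "(\<lambda>n. if n \<in> A then x n else 0) sums e \<longleftrightarrow>
      (\<lambda>n. if n \<in> Suc -` A then x (Suc n) else 0) sums (e - (if 0 \<in> A then x 0 else 0))" for A e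
    using sums_Suc_iff[of "\<lambda>n. if n \<in> A then x n else 0" "e - (if 0 \<in> A then x 0 else 0)"]
    by (simp add: vimage_def)
  show ?thesis
  proof
    assume "e \<in> achievement_set x"
    then obtain A where "(\<lambda>n. if n \<in> A then x n else 0) sums e"
      using achievement_set_iff[OF assms] by blast
    then have "e - (if 0 \<in> A then x 0 else 0) \<in> achievement_set (\<lambda>i. x (Suc i))"
      using shift iff' by blast
    then show "e \<in> achievement_set (\<lambda>i. x (Suc i)) \<or> e - x 0 \<in> achievement_set (\<lambda>i. x (Suc i))"
      by (cases "0 \<in> A") auto
  next
    have Sv: "Suc -` (Suc ` A) = A" "Suc -` insert 0 (Suc ` A) = A" for A
      by auto
    assume "e \<in> achievement_set (\<lambda>i. x (Suc i)) \<or> e - x 0 \<in> achievement_set (\<lambda>i. x (Suc i))"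
    then obtain A where "(\<lambda>n. if n \<in> A then x (Suc n) else 0) sums e \<or>
        (\<lambda>n. if n \<in> A then x (Suc n) else 0) sums (e - x 0)"
      using iff' by blast
    then show "e \<in> achievement_set x"
    proof
      assume "(\<lambda>n. if n \<in> A then x (Suc n) else 0) sums e"
      then have "(\<lambda>n. if n \<in> Suc ` A then x n else 0) sums e"
        unfolding shift Sv by simp
      then show ?thesis
        using achievement_set_iff[OF assms] by blast
    next
      assume "(\<lambda>n. if n \<in> A then x (Suc n) else 0) sums (e - x 0)"
      then have "(\<lambda>n. if n \<in> insert 0 (Suc ` A) then x n else 0) sums e"
        unfolding shift Sv by simp
      then show ?thesis
        using achievement_set_iff[OF assms] by blast
    qed
  qed
qed

text \<open>Among equal terms only the number \<open>j\<close> of chosen ones affects the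
  sum.\<close>

lemma achievement_set_const_prefix:
  fixes x :: "nat \<Rightarrow> real"
  assumes "\<And>n. 0 \<le> x n" "summable x" "\<And>i. i < c \<Longrightarrow> x i = v"
  shows "e \<in> achievement_set x \<longleftrightarrow> (\<exists>j\<le>c. e - real j * v \<in> achievement_set (\<lambda>i. x (i + c)))"
  using assms
proof (induction c arbitrary: x e)
  case 0
  then show ?case by simp
next
  case (Suc c)
  have "x 0 = v"
    using Suc.prems(3) by simp
  have IH: "d \<in> achievement_set (\<lambda>i. x (Suc i)) \<longleftrightarrow>
      (\<exists>j\<le>c. d - real j * v \<in> achievement_set (\<lambda>i. x (i + Suc c)))" for d
    using Suc.IH[of "\<lambda>i. x (Suc i)" d] Suc.prems by (simp add: summable_Suc_iff)
  have split: "(\<exists>j\<le>Suc c. P j) \<longleftrightarrow> (\<exists>j\<le>c. P j) \<or> (\<exists>j\<le>c. P (Suc j))" for P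
  proof
    assume "\<exists>j\<le>Suc c. P j"
    then obtain j where "j \<le> Suc c" "P j" by blast
    then show "(\<exists>j\<le>c. P j) \<or> (\<exists>j\<le>c. P (Suc j))"
      by (cases j) auto
  qed (auto intro: le_SucI)
  show ?case
    unfolding achievement_set_Suc[OF Suc.prems(1,2)] IH split \<open>x 0 = v\<close>
    by (simp add: algebra_simps)
qed

section \<open>Greedy expansions and closedness\<close>

text \<open>\<open>G n\<close> holds the remainders still to be represented by the terms from
  \<open>n\<close> on. Following \<open>step\<close> from \<open>e\<close> records which terms are
  subtracted; the remainders are bounded by \<open>s n\<close>, so they vanish in the limit and the
  recorded terms sum to \<open>e\<close>.\<close>

lemma greedy_in_achievement_set:
  fixes y s :: "nat \<Rightarrow> real" and G :: "nat \<Rightarrow> real set"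
  assumes y: "\<And>n. 0 \<le> y n" "summable y"
    and step: "\<And>n e. e \<in> G n \<Longrightarrow> e \<in> G (Suc n) \<or> e - y n \<in> G (Suc n)"
    and bound: "\<And>n e. e \<in> G n \<Longrightarrow> \<bar>e\<bar> \<le> s n" and s: "s \<longlonglongrightarrow> 0"
    and e: "e \<in> G 0"
  shows "e \<in> achievement_set y"
proof -
  \<comment> \<open>The clause for \<open>n = 0\<close> fixes the initial remainder, which dependent
    choice leaves open.\<close>
  have "\<exists>f. \<forall>n. (f n \<in> G n \<and> (n = 0 \<longrightarrow> f n = e)) \<and> (f (Suc n) = f n \<or> f (Suc n) = f n - y n)"
  proof (rule dependent_nat_choice)
    show "\<exists>a. a \<in> G 0 \<and> (0 = (0::nat) \<longrightarrow> a = e)"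
      using e by auto
  next
    fix a n assume "a \<in> G n \<and> (n = 0 \<longrightarrow> a = e)"
    then show "\<exists>b. (b \<in> G (Suc n) \<and> (Suc n = 0 \<longrightarrow> b = e)) \<and> (b = a \<or> b = a - y n)"
      using step by auto
  qed
  then obtain f where f: "\<And>n. f n \<in> G n" "f 0 = e"
    "\<And>n. f (Suc n) = f n \<or> f (Suc n) = f n - y n"
    by auto
  define A where "A = {n. f (Suc n) = f n - y n}"
  have partial: "(\<Sum>i<n. if i \<in> A then y i else 0) = e - f n" for n
  proof (induction n)
    case (Suc n)
    then show ?case
      using f(3)[of n] by (auto simp: A_def)
  qed (simp add: f)
  have "f \<longlonglongrightarrow> 0"
    using s by (rule Lim_null_comparison[rotated]) (use bound f in auto)
  then have "(\<lambda>n. e - f n) \<longlonglongrightarrow> e - 0"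
    by (intro tendsto_intros)
  then have "(\<lambda>i. if i \<in> A then y i else 0) sums e"
    unfolding sums_def partial by simp
  then show ?thesis
    using achievement_set_iff[OF y] by blast
qed

lemma suminf_tail_tendsto_0:
  fixes x :: "nat \<Rightarrow> real"
  assumes "summable x"
  shows "(\<lambda>n. \<Sum>i. x (i + n)) \<longlonglongrightarrow> 0"
proof -
  have "(\<lambda>n. suminf x - (\<Sum>i<n. x i)) \<longlonglongrightarrow> suminf x - suminf x"
    by (intro tendsto_intros summable_LIMSEQ assms)
  then show ?thesis
    by (simp add: suminf_minus_initial_segment[OF assms])
qed

text \<open>
  The closures of the achievement sets of the tails satisfy the same recursion as the achievement
  sets themselves, so the greedy argument applies to them as well.
\<close>

lemma closed_achievement_set:
  fixes x :: "nat \<Rightarrow> real"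
  assumes "\<And>n. 0 \<le> x n" "summable x"
  shows "closed (achievement_set x)"
proof -
  define G where "G n = closure (achievement_set (\<lambda>i. x (i + n)))" for n
  have sm: "summable (\<lambda>i. x (i + n))" for n
    using assms(2) by (rule summable_ignore_initial_segment)
  have G_Suc: "G n = G (Suc n) \<union> (+) (x n) ` G (Suc n)" for n
  proof -
    have "achievement_set (\<lambda>i. x (i + n)) =
      achievement_set (\<lambda>i. x (i + Suc n)) \<union> (+) (x n) ` achievement_set (\<lambda>i. x (i + Suc n))"
    proof (rule set_eqI)
      fix e show "e \<in> achievement_set (\<lambda>i. x (i + n)) \<longleftrightarrow> e \<in> achievement_set (\<lambda>i. x (i + Suc n)) \<union>
          (+) (x n) ` achievement_set (\<lambda>i. x (i + Suc n))"
        using achievement_set_Suc[where x = "\<lambda>i. x (i + n)" and e = e, OF assms(1) sm]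
        by (auto simp: image_iff algebra_simps intro!: bexI[of _ "e - x n"])
    qed
    then show ?thesis
      by (simp add: G_def closure_translation)
  qed
  have G_bound: "G n \<subseteq> {0..\<Sum>i. x (i + n)}" for n
    unfolding G_def
    by (rule closure_minimal) (use achievement_set_bounds[OF _ sm] assms in auto)
  have "closure (achievement_set x) \<subseteq> achievement_set x"
  proof
    fix e assume "e \<in> closure (achievement_set x)"
    then have "e \<in> G 0" by (simp add: G_def)
    show "e \<in> achievement_set x"
    proof (rule greedy_in_achievement_set[where G = G, OF assms _ _ suminf_tail_tendsto_0[OF assms(2)] \<open>e \<in> G 0\<close>])
      fix n d assume "d \<in> G n"
      then show "d \<in> G (Suc n) \<or> d - x n \<in> G (Suc n)"
        by (subst (asm) G_Suc) auto
      show "\<bar>d\<bar> \<le> (\<Sum>i. x (i + n))"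
        using \<open>d \<in> G n\<close> G_bound[of n] by auto
    qed
  qed
  then show ?thesis
    by (simp add: closure_subset_eq)
qed

text \<open>One inclusion is the greedy expansion. For the other, \<open>step\<close> read backwards
  carries \<open>0 \<in> G n\<close> to the partial sums of any subsum, which therefore lie in
  \<open>G 0\<close>; closedness admits their limit.\<close>

lemma achievement_set_eqI:
  fixes y s :: "nat \<Rightarrow> real" and G :: "nat \<Rightarrow> real set"
  assumes y: "\<And>n. 0 \<le> y n" "summable y"
    and step: "\<And>n e. e \<in> G n \<longleftrightarrow> e \<in> G (Suc n) \<or> e - y n \<in> G (Suc n)"
    and bound: "\<And>n e. e \<in> G n \<Longrightarrow> \<bar>e\<bar> \<le> s n" and s: "s \<longlonglongrightarrow> 0"
    and zero: "\<And>n. 0 \<in> G n" and closed: "closed (G 0)"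
  shows "G 0 = achievement_set y"
proof
  show "G 0 \<subseteq> achievement_set y"
    using greedy_in_achievement_set[OF y _ bound s] step by blast
  show "achievement_set y \<subseteq> G 0"
  proof
    fix e assume "e \<in> achievement_set y"
    then obtain A where "(\<lambda>n. if n \<in> A then y n else 0) sums e"
      using achievement_set_iff[OF y] by blast
    then have lim: "(\<lambda>n. \<Sum>i<n. if i \<in> A then y i else 0) \<longlonglongrightarrow> e"
      by (simp add: sums_def)
    have "(\<Sum>i<n. if i \<in> A then y i else 0) + d \<in> G 0" if "d \<in> G n" for n d
      using that
    proof (induction n arbitrary: d)
      case (Suc n)
      have "(if n \<in> A then y n else 0) + d \<in> G n"
        using Suc.prems step[of "(if n \<in> A then y n else 0) + d" n] by auto
      from Suc.IH[OF this] show ?case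
        by (simp add: algebra_simps)
    qed simp
    from this[OF zero] have mem: "(\<Sum>i<n. if i \<in> A then y i else 0) \<in> G 0" for n
      by simp
    show "e \<in> G 0"
      by (rule closed_sequentially[OF closed mem lim])
  qed
qed

subsection \<open>The leading block of a semi-fast representation\<close>

text \<open>
  \<open>E\<close> is a disjoint union of \<open>c + 1\<close> translates of \<open>L\<close>, as is the achievement set of a semi-fast
  sequence starting with exactly \<open>c\<close> copies of \<open>\<beta>\<close>. That \<open>L\<close> is an achievement set is deliberately
  not required: this would not survive the halving below.
\<close>

definition layered :: "real set \<Rightarrow> nat \<Rightarrow> real \<Rightarrow> real \<Rightarrow> real set \<Rightarrow> bool" where
  "layered E c \<beta> r L \<longleftrightarrow> L \<subseteq> {0..r} \<and> 0 \<in> L \<and> (\<forall>d\<in>L. r - d \<in> L) \<and> r < \<beta> \<and>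
     (\<forall>e. e \<in> E \<longleftrightarrow> (\<exists>j\<le>c. e - real j * \<beta> \<in> L))"

lemma layeredD:
  assumes "layered E c \<beta> r L"
  shows "\<And>d. d \<in> L \<Longrightarrow> 0 \<le> d" "\<And>d. d \<in> L \<Longrightarrow> d \<le> r" "0 \<in> L"
    "\<And>d. d \<in> L \<Longrightarrow> r - d \<in> L" "r < \<beta>" "0 \<le> r" "r \<in> L" "0 < \<beta>"
    "\<And>e. e \<in> E \<longleftrightarrow> (\<exists>j\<le>c. e - real j * \<beta> \<in> L)"
proof -
  have L: "L \<subseteq> {0..r}" "0 \<in> L" "\<forall>d\<in>L. r - d \<in> L" "r < \<beta>"
    "\<forall>e. e \<in> E \<longleftrightarrow> (\<exists>j\<le>c. e - real j * \<beta> \<in> L)"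
    using assms unfolding layered_def by blast+
  show "\<And>d. d \<in> L \<Longrightarrow> 0 \<le> d" "\<And>d. d \<in> L \<Longrightarrow> d \<le> r" "0 \<in> L"
    "\<And>d. d \<in> L \<Longrightarrow> r - d \<in> L" "r < \<beta>"
    "\<And>e. e \<in> E \<longleftrightarrow> (\<exists>j\<le>c. e - real j * \<beta> \<in> L)"
    using L by auto
  show "0 \<le> r" "0 < \<beta>"
    using L(1,2,4) by auto
  show "r \<in> L"
    using L(2,3) by force
qed

text \<open>Since \<open>r < \<beta>\<close>, the translates lie in disjoint intervals of length
  \<open>\<beta>\<close>, so the position of \<open>e\<close> determines the only translate that can
  contain it.\<close>

lemma layered_mem_iff:
  assumes "layered E c \<beta> r L" "j \<le> c" "real j * \<beta> \<le> e" "e < real (Suc j) * \<beta>"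
  shows "e \<in> E \<longleftrightarrow> e - real j * \<beta> \<in> L"
proof
  assume "e \<in> E"
  then obtain i where i: "i \<le> c" "e - real i * \<beta> \<in> L"
    using layeredD(9)[OF assms(1)] by blast
  have "e - real i * \<beta> \<ge> 0" "e - real i * \<beta> < \<beta>"
    using layeredD(1,2,5)[OF assms(1)] i(2) by fastforce+
  then have "real i * \<beta> < real (Suc j) * \<beta>" "real j * \<beta> < real (Suc i) * \<beta>"
    using assms(3,4) by (auto simp: algebra_simps)
  then have "i < Suc j" "j < Suc i"
    using layeredD(8)[OF assms(1)] by (simp_all del: of_nat_Suc)
  then show "e - real j * \<beta> \<in> L"
    using i(2) by (metis less_antisym not_less_eq)
qed (use layeredD(9)[OF assms(1)] assms(2) in blast)

text \<open>Both sides are the greatest element of the achievement set, the right one as the top of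
  the last translate.\<close>

lemma layered_suminf:
  fixes y :: "nat \<Rightarrow> real"
  assumes y: "\<And>n. 0 \<le> y n" "summable y" and lay: "layered (achievement_set y) c \<beta> r L"
  shows "suminf y = real c * \<beta> + r"
proof (rule antisym)
  obtain j where j: "j \<le> c" "suminf y - real j * \<beta> \<in> L"
    using suminf_in_achievement_set[OF y] layeredD(9)[OF lay] by blast
  have "real j * \<beta> \<le> real c * \<beta>"
    using j(1) layeredD(8)[OF lay] by simp
  then show "suminf y \<le> real c * \<beta> + r"
    using layeredD(2)[OF lay j(2)] by linarith
  have "real c * \<beta> + r - real c * \<beta> \<in> L"
    using layeredD(7)[OF lay] by simp
  then have "real c * \<beta> + r \<in> achievement_set y"
    using layeredD(9)[OF lay] by blast
  then show "real c * \<beta> + r \<le> suminf y"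
    by (rule achievement_set_bounds[OF y])
qed

text \<open>Subsums without \<open>y 0\<close> are at most the tail sum, those with it at least
  \<open>y 0\<close>. By \<open>fast\<close> a gap separates them, so a subsum reveals whether
  \<open>y 0\<close> was used.\<close>

lemma achievement_set_split_fast:
  fixes y :: "nat \<Rightarrow> real"
  assumes y: "\<And>n. 0 \<le> y n" "summable y" and fast: "(\<Sum>i. y (Suc i)) < y 0"
  shows "e \<in> achievement_set (\<lambda>i. y (Suc i)) \<longleftrightarrow> e \<in> achievement_set y \<and> e < y 0"
    and "y 0 + e \<in> achievement_set y \<longleftrightarrow>  e \<in> achievement_set (\<lambda>i. y (Suc i)) \<or> y 0 + e \<in> achievement_set (\<lambda>i. y (Suc i))"
proof -
  have sm: "summable (\<lambda>i. y (Suc i))"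
    using y by (simp add: summable_Suc_iff)
  note b = achievement_set_bounds[where x = "\<lambda>i. y (Suc i)", OF y(1) sm]
  show "e \<in> achievement_set (\<lambda>i. y (Suc i)) \<longleftrightarrow> e \<in> achievement_set y \<and> e < y 0"
    using achievement_set_Suc[OF y, of e] b[of e] b[of "e - y 0"] fast by force
  show "y 0 + e \<in> achievement_set y \<longleftrightarrow>  e \<in> achievement_set (\<lambda>i. y (Suc i)) \<or> y 0 + e \<in> achievement_set (\<lambda>i. y (Suc i))"
    using achievement_set_Suc[OF y, of "y 0 + e"] by auto
qed

text \<open>There are \<open>2 * h + 2\<close> translates, so by symmetry the central gap lies
  between the translates \<open>h\<close> and \<open>h + 1\<close>. The gap between
  \<open>\<rho>\<close> and \<open>y 0\<close> is central too, so \<open>y 0\<close> is the first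
  point of translate \<open>h + 1\<close>.\<close>

lemma layered_odd:
  fixes y :: "nat \<Rightarrow> real"
  assumes y: "\<And>n. 0 \<le> y n" "summable y" and fast: "(\<Sum>i. y (Suc i)) < y 0"
    and lay: "layered (achievement_set y) (2 * h + 1) \<beta> r L"
  shows "y 0 = real (Suc h) * \<beta>"
    and "e \<in> achievement_set (\<lambda>i. y (Suc i)) \<longleftrightarrow> (\<exists>j\<le>h. e - real j * \<beta> \<in> L)"
proof -
  define \<rho> where "\<rho> = (\<Sum>i. y (Suc i))"
  have sm: "summable (\<lambda>i. y (Suc i))"
    using y by (simp add: summable_Suc_iff)
  note b = achievement_set_bounds[where x = "\<lambda>i. y (Suc i)", OF y(1) sm]
  note F = achievement_set_split_fast(1)[OF y fast]
  have S: "y 0 + \<rho> = 2 * (real h * \<beta>) + \<beta> + r"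
    using layered_suminf[OF y lay] suminf_split_head[OF y(2)] by (simp add: \<rho>_def algebra_simps)
  have "real (Suc h) * \<beta> - real (Suc h) * \<beta> \<in> L"
    using layeredD(3)[OF lay] by simp
  then have mem: "real (Suc h) * \<beta> \<in> achievement_set y"
    using layeredD(9)[OF lay, of "real (Suc h) * \<beta>"] by (auto simp del: of_nat_Suc intro!: exI[of _ "Suc h"])
  \<comment> \<open>Otherwise this point is below the gap, hence at most \<open>\<rho>\<close>, and
    \<open>y 0 + \<rho>\<close> exceeds twice its value, which is more than the total.\<close>
  have ge: "y 0 \<le> real (Suc h) * \<beta>"
  proof (rule ccontr)
    assume "\<not> y 0 \<le> real (Suc h) * \<beta>"
    then have "real (Suc h) * \<beta> \<le> \<rho>"
      using F mem b \<rho>_def by auto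
    then show False
      using S fast layeredD(5)[OF lay] unfolding \<rho>_def by (simp add: algebra_simps)
  qed
  have "y 0 \<in> achievement_set y"
    using achievement_set_Suc[OF y, of "y 0"] zero_in_achievement_set by simp
  then obtain j where j: "j \<le> 2 * h + 1" "y 0 - real j * \<beta> \<in> L"
    using layeredD(9)[OF lay] by blast
  \<comment> \<open>If \<open>j \<le> h\<close>, then \<open>y 0\<close> and the smaller
    \<open>\<rho>\<close> are at most \<open>h * \<beta> + r\<close>; as \<open>r < \<beta>\<close>,
    their sum falls short of the total.\<close>
  have "Suc h \<le> j"
  proof (rule ccontr)
    assume "\<not> Suc h \<le> j"
    then have "real j * \<beta> \<le> real h * \<beta>"
      using layeredD(8)[OF lay] by simp
    then show False
      using S fast layeredD(2)[OF lay j(2)] layeredD(5)[OF lay] unfolding \<rho>_def by linarith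
  qed
  then have "real (Suc h) * \<beta> \<le> real j * \<beta>"
    using layeredD(8)[OF lay] by (simp del: of_nat_Suc)
  then show y0: "y 0 = real (Suc h) * \<beta>"
    using ge layeredD(1)[OF lay j(2)] by linarith
  show "e \<in> achievement_set (\<lambda>i. y (Suc i)) \<longleftrightarrow> (\<exists>j\<le>h. e - real j * \<beta> \<in> L)"
  proof
    assume "e \<in> achievement_set (\<lambda>i. y (Suc i))"
    then have "e \<in> achievement_set y" "e < real (Suc h) * \<beta>"
      using F y0 by auto
    then obtain j where j: "e - real j * \<beta> \<in> L"
      using layeredD(9)[OF lay] by blast
    then have "real j * \<beta> < real (Suc h) * \<beta>"
      using layeredD(1)[OF lay j] \<open>e < _\<close> by linarith
    then have "j \<le> h"
      using layeredD(8)[OF lay] by (simp del: of_nat_Suc)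
    with j show "\<exists>j\<le>h. e - real j * \<beta> \<in> L"
      by blast
  next
    assume "\<exists>j\<le>h. e - real j * \<beta> \<in> L"
    then obtain j where j: "j \<le> h" "e - real j * \<beta> \<in> L"
      by blast
    have "real j * \<beta> \<le> real h * \<beta>"
      using layeredD(8)[OF lay] j(1) by simp
    then have "e < real (Suc h) * \<beta>"
      using layeredD(2)[OF lay j(2)] layeredD(5)[OF lay] by (simp add: algebra_simps)
    moreover have "e \<in> achievement_set y"
      using layeredD(9)[OF lay] j by (auto intro!: exI[of _ j])
    ultimately show "e \<in> achievement_set (\<lambda>i. y (Suc i))"
      using F y0 by auto
  qed
qed

text \<open>
  For even \<open>c\<close> the central gap of \<open>E\<close> lies inside the middle translate of \<open>L\<close>. Comparing the two
  halves of \<open>E\<close> around this gap shows that \<open>L\<close> itself consists of two translates of a set at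
  distance \<open>\<beta> / 2\<close>, and the left half of \<open>E\<close> is layered with the same \<open>c\<close> and half the \<open>\<beta>\<close>.
\<close>

lemma layered_even_halve:
  fixes y :: "nat \<Rightarrow> real"
  assumes y: "\<And>n. 0 \<le> y n" "summable y" and fast: "(\<Sum>i. y (Suc i)) < y 0"
    and lay: "layered (achievement_set y) (2 * h) \<beta> r L" and h: "1 \<le> h"
  shows "y 0 = real (2 * h + 1) * (\<beta> / 2)"
    and "\<exists>r' G. layered (achievement_set (\<lambda>i. y (Suc i))) (2 * h) (\<beta> / 2) r' G"
proof -
  define \<rho> where "\<rho> = (\<Sum>i. y (Suc i))"
  define F where "F = achievement_set (\<lambda>i. y (Suc i))"
  define E where "E = achievement_set y"
  define H where "H = real h * \<beta>"
  have sm: "summable (\<lambda>i. y (Suc i))"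
    using y by (simp add: summable_Suc_iff)
  have F_le: "f \<le> \<rho>" if "f \<in> F" for f
    using achievement_set_bounds(2)[where x = "\<lambda>i. y (Suc i)", OF y(1) sm] that
    by (simp add: F_def \<rho>_def)
  have F_iff: "f \<in> F \<longleftrightarrow> f \<in> E \<and> f < y 0" for f
    using achievement_set_split_fast(1)[OF y fast] by (simp add: F_def E_def)
  have F_add: "y 0 + f \<in> E" if "f \<in> F" for f
    using achievement_set_split_fast(2)[OF y fast] that by (auto simp: F_def E_def)
  have F_diff: "f - y 0 \<in> F" if "f \<in> E" "y 0 \<le> f" for f
    using achievement_set_split_fast[OF y fast, of "f - y 0"] that
      achievement_set_split_fast(1)[OF y fast, of f] by (auto simp: F_def E_def)
  note layD = layeredD[OF lay, folded E_def]
  have E_iff: "e \<in> E \<longleftrightarrow> (\<exists>j\<le>2 * h. e - real j * \<beta> \<in> L)" for e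
    by (rule layD(9))
  have "1 * \<beta> \<le> H"
    unfolding H_def using h layD(8) by (intro mult_right_mono) auto
  then have "\<beta> \<le> H" by simp
  have E_0: "e \<in> E \<longleftrightarrow> e \<in> L" if "0 \<le> e" "e < \<beta>" for e
    using layered_mem_iff[OF lay, of 0 e] that by (simp add: E_def)
  have E_h: "H + e \<in> E \<longleftrightarrow> e \<in> L" if "0 \<le> e" "e < \<beta>" for e
    using layered_mem_iff[OF lay, of h "H + e"] that by (simp add: E_def H_def algebra_simps)
  have E_Suc: "H + \<beta> + e \<in> E \<longleftrightarrow> e \<in> L" if "0 \<le> e" "e < \<beta>" for e
    using layered_mem_iff[OF lay, of "Suc h" "H + \<beta> + e"] that h by (simp add: E_def H_def algebra_simps)
  have S: "y 0 + \<rho> = 2 * H + r"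
    using layered_suminf[OF y lay] suminf_split_head[OF y(2)] by (simp add: \<rho>_def H_def)
  have fast': "\<rho> < y 0"
    using fast by (simp add: \<rho>_def)
  have "y 0 \<in> E"
    using achievement_set_Suc[OF y, of "y 0"] zero_in_achievement_set by (simp add: E_def)
  have "H + r \<in> E"
    using E_h[of r] layD by simp
  have "y 0 \<le> H + r"
    using F_iff[of "H + r"] F_le[of "H + r"] \<open>H + r \<in> E\<close> S fast' layD(6) by linarith
  \<comment> \<open>\<open>H\<close> is the start of the middle translate. The aim of the following
    steps is \<open>e = \<beta> / 2\<close>.\<close>
  define e where "e = y 0 - H"
  have y0: "y 0 = H + e"
    by (simp add: e_def)
  have "e \<le> r" "r < 2 * e"
    using \<open>y 0 \<le> H + r\<close> S fast' by (auto simp: e_def)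
  have "0 < e"
    using \<open>r < 2 * e\<close> layD(6) by linarith
  have "e \<in> L"
    using E_h[of e] \<open>y 0 \<in> E\<close> y0 \<open>0 < e\<close> \<open>e \<le> r\<close> layD(5) by simp
  have \<rho>: "\<rho> = H + r - e"
    using S y0 by linarith
  have r_F: "r \<in> F"
    using F_iff[of r] E_0[of r] layD(5,6,7) \<open>\<beta> \<le> H\<close> \<open>0 < e\<close> y0 by simp
  \<comment> \<open>Points of the middle translate below \<open>y 0\<close> are subsums of the tail,
    hence at most \<open>\<rho> = H + r - e\<close>. So \<open>L\<close> has no point strictly
    between \<open>r - e\<close> and \<open>e\<close>.\<close>
  have below_e: "d \<le> r - e" if "d \<in> L" "d < e" for d
  proof -
    have "H + d \<in> F"
      using F_iff[of "H + d"] E_h[of d] that layD(1)[OF that(1)] y0 \<open>e \<le> r\<close> layD(5) by simp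
    then show ?thesis
      using F_le \<rho> by fastforce
  qed
  \<comment> \<open>Otherwise \<open>y 0 + r = H + (e + r)\<close> would lie in the middle
    translate, above its top \<open>H + r\<close>.\<close>
  have "\<beta> \<le> e + r"
  proof (rule ccontr)
    assume "\<not> \<beta> \<le> e + r"
    then have "e + r \<in> L"
      using F_add[OF r_F] E_h[of "e + r"] y0 \<open>0 < e\<close> layD(6) by (simp add: algebra_simps)
    then show False
      using layD(2) \<open>0 < e\<close> by fastforce
  qed
  \<comment> \<open>Reflecting \<open>e\<close> in \<open>L\<close> gives the point
    \<open>r - e\<close> of the next translate. Subtracting \<open>y 0\<close> there leaves
    \<open>\<beta> + r - 2 * e\<close>, which falls into the translate at 0 and so is at most
    \<open>r\<close>.\<close>
  have "\<beta> \<le> 2 * e"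
  proof -
    have "r - e \<in> L"
      using layD(4) \<open>e \<in> L\<close> by blast
    then have "H + \<beta> + (r - e) \<in> E"
      using E_Suc[of "r - e"] \<open>e \<le> r\<close> \<open>0 < e\<close> layD(5) by simp
    then have "\<beta> + r - 2 * e \<in> F"
      using F_diff[of "H + \<beta> + (r - e)"] y0 \<open>e \<le> r\<close> layD(5) by (simp add: algebra_simps)
    moreover have "0 \<le> \<beta> + r - 2 * e" "\<beta> + r - 2 * e < \<beta>"
      using \<open>e \<le> r\<close> layD(5) \<open>r < 2 * e\<close> by auto
    ultimately have "\<beta> + r - 2 * e \<in> L"
      using F_iff E_0 by blast
    then show ?thesis
      using layD(2) by fastforce
  qed
  \<comment> \<open>Now \<open>y 0 + r\<close> lies in the translate after the middle one, so
    \<open>e + r - \<beta>\<close> is in \<open>L\<close>. It is below \<open>e\<close>, hence at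
    most \<open>r - e\<close> by the gap of \<open>L\<close>.\<close>
  moreover have "2 * e \<le> \<beta>"
  proof -
    have "e + r - \<beta> \<in> L"
      using F_add[OF r_F] E_Suc[of "e + r - \<beta>"] y0 \<open>\<beta> \<le> e + r\<close> \<open>e \<le> r\<close> layD(5)
      by (simp add: algebra_simps)
    then show ?thesis
      using below_e[of "e + r - \<beta>"] layD(5) by linarith
  qed
  ultimately have \<beta>: "\<beta> = 2 * e" by linarith
  show "y 0 = real (2 * h + 1) * (\<beta> / 2)"
    using y0 \<beta> by (simp add: H_def algebra_simps)
  \<comment> \<open>The gap splits \<open>L\<close> into its lower part \<open>G\<close>, with top
    \<open>r'\<close>, and the copy \<open>e + G\<close>.\<close>
  define r' where "r' = r - e"
  have "r' < e"
    using \<open>r < 2 * e\<close> by (simp add: r'_def)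
  define G where "G = {d \<in> L. d \<le> r'}"
  have shift_up: "e + d \<in> L" if "d \<in> G" for d
  proof -
    have d: "d \<in> L" "d \<le> r'" "0 \<le> d"
      using that layD(1) by (auto simp: G_def)
    then have "d \<in> F"
      using F_iff[of d] E_0[of d] \<open>r' < e\<close> y0 \<open>\<beta> \<le> H\<close> \<open>0 < e\<close> \<beta> by simp
    then have "H + (e + d) \<in> E"
      using F_add[of d] y0 by (simp add: add.assoc)
    then show ?thesis
      using E_h[of "e + d"] d \<open>0 < e\<close> layD(5) by (simp add: r'_def)
  qed
  have sym: "r' - d \<in> G" if "d \<in> G" for d
    using layD(4)[OF shift_up[OF that]] that layD(1)[of d] by (auto simp: G_def r'_def algebra_simps)
  have shift_down: "d - e \<in> G" if "d \<in> L" "e \<le> d" for d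
    using sym[of "r - d"] layD(4)[OF that(1)] that(2) by (simp add: G_def r'_def)
  have small: "d \<in> G" if "d \<in> L" "d < e" for d
    using that below_e by (simp add: G_def r'_def)
  \<comment> \<open>The translates of \<open>L\<close> before the middle one contribute two
    translates of \<open>G\<close> each, the middle one only its lower half because
    \<open>f < y 0\<close>. This makes \<open>2 * h + 1\<close> in all.\<close>
  have "f \<in> F \<longleftrightarrow> (\<exists>j\<le>2 * h. f - real j * (\<beta> / 2) \<in> G)" for f
  proof
    assume "f \<in> F"
    then have f: "f \<in> E" "f < y 0"
      using F_iff by auto
    then obtain j where j: "f - real j * \<beta> \<in> L"
      using E_iff by blast
    then have "real j * \<beta> \<le> f"
      using layD(1) by fastforce
    also have "f < real (Suc h) * \<beta>"
      using f y0 \<beta> \<open>0 < e\<close> by (simp add: H_def algebra_simps)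
    finally have "j \<le> h"
      using layD(8) by (simp del: of_nat_Suc)
    show "\<exists>j\<le>2 * h. f - real j * (\<beta> / 2) \<in> G"
    proof (cases "f - real j * \<beta> < e")
      case True
      then show ?thesis
        using small[OF j] \<open>j \<le> h\<close> by (intro exI[of _ "2 * j"]) simp
    next
      case False
      have "j \<noteq> h"
        using False f y0 by (auto simp: H_def)
      then show ?thesis
        using shift_down[OF j] False \<open>j \<le> h\<close> \<beta>
        by (intro exI[of _ "2 * j + 1"]) (simp add: algebra_simps)
    qed
  next
    assume "\<exists>j\<le>2 * h. f - real j * (\<beta> / 2) \<in> G"
    then obtain j where j: "j \<le> 2 * h" "f - real j * (\<beta> / 2) \<in> G"
      by blast
    show "f \<in> F"
    proof (cases "even j")
      case True
      then obtain i where i: "j = 2 * i"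
        by (auto elim: evenE)
      then have "i \<le> h"
        using j by simp
      have mem: "f - real i * \<beta> \<in> G"
        using j i by (simp add: field_simps)
      then have "f \<in> E"
        using E_iff \<open>i \<le> h\<close> by (auto simp: G_def intro!: exI[of _ i])
      moreover have "real i * \<beta> \<le> H"
        using \<open>i \<le> h\<close> layD(8) by (simp add: H_def)
      then have "f < y 0"
        using mem \<open>r' < e\<close> y0 by (simp add: G_def)
      ultimately show ?thesis
        using F_iff by blast
    next
      case False
      then obtain i where i: "j = 2 * i + 1"
        by (auto elim: oddE)
      then have "Suc i \<le> h"
        using j by simp
      have "f - real i * \<beta> - e \<in> G"
        using j i \<beta> by (simp add: algebra_simps)
      from shift_up[OF this] have mem: "f - real i * \<beta> \<in> L"
        by simp
      then have "f \<in> E"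
        using E_iff \<open>Suc i \<le> h\<close> by (auto intro!: exI[of _ i])
      moreover have "real (Suc i) * \<beta> \<le> H"
        using \<open>Suc i \<le> h\<close> layD(8) by (simp add: H_def del: of_nat_Suc)
      then have "f < y 0"
        using layD(2)[OF mem] layD(5) y0 \<open>0 < e\<close> by (simp add: algebra_simps)
      ultimately show ?thesis
        using F_iff by blast
    qed
  qed
  moreover have "G \<subseteq> {0..r'}" "0 \<in> G"
    using layD(1,3) \<open>e \<le> r\<close> by (auto simp: G_def r'_def)
  ultimately have "layered F (2 * h) (\<beta> / 2) r' G"
    unfolding layered_def using sym \<open>r' < e\<close> \<beta> by auto
  then show "\<exists>r' G. layered (achievement_set (\<lambda>i. y (Suc i))) (2 * h) (\<beta> / 2) r' G"
    by (auto simp: F_def)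
qed

text \<open>If every term from \<open>n\<close> on were twice its successor, the tail after
  \<open>n\<close> would sum to exactly \<open>y n\<close>.\<close>

lemma fast_not_halving:
  fixes y :: "nat \<Rightarrow> real"
  assumes "summable y" "(\<Sum>i. y (i + Suc n)) < y n"
  shows "\<exists>m\<ge>n. y m \<noteq> 2 * y (Suc m)"
proof (rule ccontr)
  assume "\<not> ?thesis"
  then have "y (i + n) = 2 * y (Suc (i + n))" for i
    using le_add2 by blast
  then have eq: "(\<lambda>i. y (i + n)) = (\<lambda>i. 2 * y (i + Suc n))"
    by simp
  have sm: "summable (\<lambda>i. y (i + k))" for k
    using assms(1) by (rule summable_ignore_initial_segment)
  have "(\<Sum>i. y (i + n)) = 2 * (\<Sum>i. y (i + Suc n))"
    unfolding eq by (rule suminf_mult[OF sm])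
  moreover have "(\<Sum>i. y (i + n)) = (\<Sum>i. y (i + Suc n)) + y n"
    using suminf_split_head[OF sm, of n] by simp
  ultimately show False
    using assms(2) by linarith
qed

text \<open>Halving preserves \<open>2 * h\<close>, so it applies again to each tail of
  \<open>y\<close>. It determines every \<open>y n\<close>, and the ratio is exactly 1/2.\<close>

lemma not_layered_even:
  fixes y :: "nat \<Rightarrow> real"
  assumes y: "\<And>n. 0 \<le> y n" "summable y" and fast: "\<And>n. (\<Sum>i. y (i + Suc n)) < y n"
    and h: "1 \<le> h"
  shows "\<not> layered (achievement_set y) (2 * h) \<beta> r L"
proof
  assume lay: "layered (achievement_set y) (2 * h) \<beta> r L"
  have sm: "summable (\<lambda>i. y (i + k))" for k
    using y(2) by (rule summable_ignore_initial_segment)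
  have "\<exists>r L. layered (achievement_set (\<lambda>i. y (i + n))) (2 * h) (\<beta> / 2 ^ n) r L" for n
  proof (induction n)
    case 0
    then show ?case using lay by auto
  next
    case (Suc n)
    then obtain r L where "layered (achievement_set (\<lambda>i. y (i + n))) (2 * h) (\<beta> / 2 ^ n) r L"
      by blast
    from layered_even_halve(2)[where y = "\<lambda>i. y (i + n)", OF y(1) sm _ this h] fast[of n]
    show ?case by (simp add: mult.commute)
  qed
  then have y_eq: "y n = real (2 * h + 1) * (\<beta> / 2 ^ n / 2)" for n
    using layered_even_halve(1)[where y = "\<lambda>i. y (i + n)", OF y(1) sm _ _ h] fast[of n] by fastforce
  have "y n = 2 * y (Suc n)" for n
    by (simp add: y_eq[of n] y_eq[of "Suc n"] field_simps)
  then show False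
    using fast_not_halving[OF y(2) fast[of 0]] by blast
qed

text \<open>One round of the comparison of \<open>x\<close> with \<open>y\<close>. Only
  \<open>h + 1\<close> of the \<open>2 * h + 1\<close> leading copies are removed, matching the
  single term \<open>y 0\<close>.\<close>

lemma semi_fast_leading_block:
  fixes x y :: "nat \<Rightarrow> real"
  assumes x: "\<And>n. 0 < x n" "summable x" "decseq x"
    and sf: "\<And>n. x (Suc n) < x n \<Longrightarrow> (\<Sum>i. x (i + Suc n)) < x n"
    and y: "\<And>n. 0 < y n" "summable y" and fast: "\<And>n. (\<Sum>i. y (i + Suc n)) < y n"
    and eq: "achievement_set x = achievement_set y"
  shows "\<exists>h. y 0 = real (Suc h) * x 0 \<and> (\<forall>i<2 * h + 1. x i = x 0) \<and> x (2 * h + 1) < x 0 \<and>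
    achievement_set (\<lambda>i. x (i + Suc h)) = achievement_set (\<lambda>i. y (Suc i))"
proof -
  have x0: "\<And>n. 0 \<le> x n" and y0: "\<And>n. 0 \<le> y n"
    using x y by (auto intro: less_imp_le)
  have sm: "summable (\<lambda>i. x (i + k))" for k
    using x(2) by (rule summable_ignore_initial_segment)
  have "eventually (\<lambda>n. x n < x 0) sequentially"
    using summable_LIMSEQ_zero[OF x(2)] x(1) by (rule order_tendstoD)
  then have ex: "\<exists>n. x n < x 0"
    by (auto simp: eventually_sequentially)
  define c where "c = (LEAST n. x n < x 0)"
  have c: "x c < x 0"
    unfolding c_def using ex by (rule LeastI_ex)
  have prefix: "x i = x 0" if "i < c" for i
    using not_less_Least[of i "\<lambda>n. x n < x 0"] that x(3) unfolding c_def
    by (metis decseqD antisym not_less zero_le)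
  have "c \<noteq> 0"
    using c by (metis less_irrefl)
  then obtain c' where c': "c = Suc c'"
    by (cases c) auto
  define r where "r = (\<Sum>i. x (i + c))"
  \<comment> \<open>\<open>c'\<close> is the last index of the leading block; \<open>x\<close> drops
    there, so \<open>sf\<close> applies.\<close>
  have "r < x 0"
    using sf[of c'] c prefix[of c'] by (simp add: r_def c')
  have "achievement_set (\<lambda>i. x (i + c)) \<subseteq> {0..r}"
    unfolding r_def using achievement_set_bounds[OF x0 sm] by auto
  then have lay: "layered (achievement_set y) c (x 0) r (achievement_set (\<lambda>i. x (i + c)))"
    unfolding layered_def
    using zero_in_achievement_set achievement_set_reflect[where x = "\<lambda>i. x (i + c)", OF x0 sm] \<open>r < x 0\<close>
      achievement_set_const_prefix[OF x0 x(2) prefix]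
    by (auto simp: eq r_def)
  have "odd c"
  proof
    assume "even c"
    then obtain h where "c = 2 * h"
      by (auto elim: evenE)
    then show False
      using not_layered_even[OF y0 y(2) fast, of h] lay \<open>c \<noteq> 0\<close> by force
  qed
  then obtain h where h: "c = 2 * h + 1"
    by (auto elim: oddE)
  have "(\<Sum>i. y (Suc i)) < y 0"
    using fast[of 0] by simp
  note odd = layered_odd[OF y0 y(2) this lay[unfolded h]]
  \<comment> \<open>After the removal \<open>h\<close> copies still precede the same tail, which
    gives the \<open>h + 1\<close> translates of \<open>odd(2)\<close>.\<close>
  have pref: "x (i + Suc h) = x 0" if "i < h" for i
    using prefix[of "i + Suc h"] h that by simp
  have "e \<in> achievement_set (\<lambda>i. x (i + Suc h)) \<longleftrightarrow> e \<in> achievement_set (\<lambda>i. y (Suc i))" for e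
  proof -
    have "(\<lambda>i. x (i + h + Suc h)) = (\<lambda>i. x (i + c))"
      by (simp add: h mult_2_right ac_simps)
    then show ?thesis
      using achievement_set_const_prefix[where x = "\<lambda>i. x (i + Suc h)" and v = "x 0" and e = e and c = h,
          OF x0 sm pref]
      by (simp add: odd(2) h)
  qed
  then have "achievement_set (\<lambda>i. x (i + Suc h)) = achievement_set (\<lambda>i. y (Suc i))"
    by blast
  with odd(1) prefix c show ?thesis
    unfolding h by blast
qed

subsection \<open>Merging geometric runs\<close>

lemma block_index:
  fixes g :: "nat \<Rightarrow> nat"
  assumes "\<And>n. 0 < g n"
  obtains n i where "k = (\<Sum>j<n. g j) + i" "i < g n"
proof -
  have "\<exists>n i. k = (\<Sum>j<n. g j) + i \<and> i < g n"
  proof (induction k)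
    case 0
    show ?case
      using assms[of 0] by (intro exI[of _ 0]) auto
  next
    case (Suc k)
    then obtain n i where k: "k = (\<Sum>j<n. g j) + i" "i < g n"
      by blast
    show ?case
    proof (cases "Suc i < g n")
      case True
      with k show ?thesis
        by (intro exI[of _ n] exI[of _ "Suc i"]) simp
    next
      case False
      with k have "Suc k = (\<Sum>j<Suc n. g j) + 0"
        by simp
      with assms[of "Suc n"] show ?thesis
        by blast
    qed
  qed
  with that show ?thesis by blast
qed

text \<open>
  Each \<open>y n\<close> is replaced by \<open>2 ^ l n\<close> copies of \<open>y n / 2 ^ l n\<close>. The condition looks beyond these
  copies: the value persists for \<open>2 ^ Suc (l n) - 1\<close> terms, as happens when \<open>y n\<close> heads a run
  \<open>2 ^ l n * \<beta>, \<dots>, 2 * \<beta>, \<beta>\<close> of \<open>l n + 1\<close> terms of \<open>y\<close>.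
\<close>

definition grouped :: "(nat \<Rightarrow> real) \<Rightarrow> (nat \<Rightarrow> real) \<Rightarrow> (nat \<Rightarrow> nat) \<Rightarrow> bool" where
  "grouped x y l \<longleftrightarrow>
     (\<forall>n i. i < 2 ^ Suc (l n) - 1 \<longrightarrow> x ((\<Sum>k<n. 2 ^ l k) + i) = y n / 2 ^ l n)"

lemma groupedD:
  assumes "grouped x y l" "i < 2 ^ l n"
  shows "x ((\<Sum>k<n. 2 ^ l k) + i) = y n / 2 ^ l n"
proof -
  have "i < 2 ^ Suc (l n) - 1"
    using assms(2) by simp
  then show ?thesis
    using assms(1) unfolding grouped_def by blast
qed

lemma grouped_start:
  assumes "grouped x y l"
  shows "x (\<Sum>k<n. 2 ^ l k) = y n / 2 ^ l n"
  using groupedD[OF assms, of 0 n] by simp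

text \<open>The first \<open>2 ^ l n\<close> entries from each offset already cover all
  positions.\<close>

lemma grouped_unique:
  assumes "grouped x y l" "grouped x' y l"
  shows "x = x'"
proof
  fix k :: nat
  obtain n i where "k = (\<Sum>j<n. 2 ^ l j) + i" "i < 2 ^ l n"
    by (rule block_index[of "\<lambda>n. 2 ^ l n" k]) auto
  then show "x k = x' k"
    using assms[THEN groupedD] by simp
qed

text \<open>The offset of \<open>n\<close> depends only on earlier exponents, so by induction the
  offsets agree, and the entry found there determines the exponent.\<close>

lemma grouped_exponent_unique:
  assumes "grouped x y l" "grouped x y l'" "\<And>n. 0 < y n"
  shows "l = l'"
proof
  fix n show "l n = l' n"
  proof (induction n rule: less_induct)
    case (less n)
    then have "(\<Sum>k<n. 2 ^ l k) = (\<Sum>k<n. (2::nat) ^ l' k)"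
      by (intro sum.cong) auto
    then have "y n / 2 ^ l n = y n / 2 ^ l' n"
      using grouped_start[OF assms(1), of n] grouped_start[OF assms(2), of n] by auto
    with assms(3)[of n] show ?case
      by auto
  qed
qed

lemma strict_mono_offset:
  fixes l :: "nat \<Rightarrow> nat"
  shows "strict_mono (\<lambda>n. \<Sum>k<n. (2::nat) ^ l k)"
  by (simp add: strict_mono_Suc_iff)

lemma Ex_le_double:
  fixes Q :: "nat \<Rightarrow> bool"
  assumes "0 < a"
  shows "(\<exists>j\<le>2 * a - 1. Q j) \<longleftrightarrow> (\<exists>j\<le>a - 1. Q j) \<or> (\<exists>j\<le>a - 1. Q (a + j))"
proof
  assume "\<exists>j\<le>2 * a - 1. Q j"
  then obtain j where "j \<le> 2 * a - 1" "Q j" by blast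
  then show "(\<exists>j\<le>a - 1. Q j) \<or> (\<exists>j\<le>a - 1. Q (a + j))"
    by (cases "j < a") (auto intro: exI[of _ "j - a"])
next
  assume "(\<exists>j\<le>a - 1. Q j) \<or> (\<exists>j\<le>a - 1. Q (a + j))"
  then show "\<exists>j\<le>2 * a - 1. Q j"
  proof
    assume "\<exists>j\<le>a - 1. Q j"
    then obtain j where "j \<le> a - 1" "Q j" by blast
    then show ?thesis by (intro exI[of _ j]) auto
  next
    assume "\<exists>j\<le>a - 1. Q (a + j)"
    then obtain j where "j \<le> a - 1" "Q (a + j)" by blast
    then show ?thesis using assms by (intro exI[of _ "a + j"]) auto
  qed
qed

text \<open>The \<open>2 * a - 1\<close> equal terms at \<open>p n\<close> allow the multiplicities
  0 to \<open>2 * a - 1\<close>. The two halves of this range correspond to omitting or using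
  \<open>y n = a * v\<close>, with \<open>a - 1\<close> copies left at \<open>p (Suc n)\<close>. So
  the tails of \<open>x\<close> obey the recursion of \<open>y\<close>.\<close>

lemma achievement_set_grouped:
  fixes x y :: "nat \<Rightarrow> real"
  assumes x: "\<And>n. 0 \<le> x n" "summable x" and y: "\<And>n. 0 \<le> y n" "summable y"
    and gr: "grouped x y l"
  shows "achievement_set x = achievement_set y"
proof -
  define p where "p n = (\<Sum>k<n. (2::nat) ^ l k)" for n
  define G where "G n = achievement_set (\<lambda>i. x (i + p n))" for n
  have sm: "summable (\<lambda>i. x (i + k))" for k
    using x(2) by (rule summable_ignore_initial_segment)
  have "G 0 = achievement_set y"
  proof (rule achievement_set_eqI[OF y, where s = "\<lambda>n. \<Sum>i. x (i + p n)"])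
    fix n e
    define a where "a = (2::nat) ^ l n"
    define v where "v = y n / 2 ^ l n"
    \<comment> \<open>This tail starts after all the equal terms, so it serves for both
      \<open>G n\<close> and \<open>G (Suc n)\<close>.\<close>
    define T where "T = achievement_set (\<lambda>i. x (i + (2 * a - 1) + p n))"
    have "0 < a" by (simp add: a_def)
    have v: "x (i + p n) = v" if "i < 2 * a - 1" for i
      using gr that unfolding grouped_def p_def a_def v_def by (simp add: add.commute)
    have G_n: "d \<in> G n \<longleftrightarrow> (\<exists>j\<le>2 * a - 1. d - real j * v \<in> T)" for d
      unfolding G_def T_def by (rule achievement_set_const_prefix[OF x(1) sm v])
    have p_Suc: "p (Suc n) = p n + a"
      by (simp add: p_def a_def)
    have G_Suc: "d \<in> G (Suc n) \<longleftrightarrow> (\<exists>j\<le>a - 1. d - real j * v \<in> T)" for d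
    proof -
      have "x (i + p (Suc n)) = v" if "i < a - 1" for i
        using v[of "i + a"] that by (simp add: p_Suc ac_simps)
      moreover have "(\<lambda>i. x (i + (a - 1) + p (Suc n))) = (\<lambda>i. x (i + (2 * a - 1) + p n))"
        using \<open>0 < a\<close> by (intro ext arg_cong[where f = x]) (simp add: p_Suc)
      ultimately show ?thesis
        unfolding G_def T_def
        using achievement_set_const_prefix[where x = "\<lambda>i. x (i + p (Suc n))" and c = "a - 1" and v = v,
            OF x(1) sm] by simp
    qed
    have "y n = real a * v"
      by (simp add: v_def a_def)
    then show "e \<in> G n \<longleftrightarrow> e \<in> G (Suc n) \<or> e - y n \<in> G (Suc n)"
      unfolding G_n G_Suc Ex_le_double[OF \<open>0 < a\<close>] by (simp add: algebra_simps)
  next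
    fix n e assume "e \<in> G n"
    then show "\<bar>e\<bar> \<le> (\<Sum>i. x (i + p n))"
      unfolding G_def using achievement_set_bounds[where x = "\<lambda>i. x (i + p n)", OF x(1) sm] by fastforce
  next
    have "strict_mono p"
      unfolding p_def by (rule strict_mono_offset)
    then show "(\<lambda>n. \<Sum>i. x (i + p n)) \<longlonglongrightarrow> 0"
      using LIMSEQ_subseq_LIMSEQ[OF suminf_tail_tendsto_0[OF x(2)]] by (simp add: o_def)
  next
    show "0 \<in> G n" for n
      unfolding G_def by (rule zero_in_achievement_set)
    show "closed (G 0)"
      unfolding G_def by (rule closed_achievement_set[OF x(1) sm])
  qed
  then show ?thesis
    by (simp add: G_def p_def)
qed

lemma sum_grouped:
  assumes "grouped x y l"
  shows "(\<Sum>k<(\<Sum>j<n. 2 ^ l j). x k) = (\<Sum>j<n. y j)"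
proof (induction n)
  case (Suc n)
  let ?p = "\<Sum>j<n. (2::nat) ^ l j"
  have split: "(\<Sum>k<m + a. x k) = (\<Sum>k<m. x k) + (\<Sum>i<a. x (m + i))" for m a
    by (induction a) auto
  have "(\<Sum>i<2 ^ l n. x (?p + i)) = (\<Sum>i<(2::nat) ^ l n. y n / 2 ^ l n)"
    by (intro sum.cong refl groupedD[OF assms]) auto
  with Suc show ?case
    by (simp add: split)
qed simp

lemma suminf_grouped:
  fixes x y :: "nat \<Rightarrow> real"
  assumes "grouped x y l" "summable x" "summable y"
  shows "(\<Sum>i. x (i + (\<Sum>j<n. 2 ^ l j))) = (\<Sum>i. y (i + n))"
proof -
  have "(\<lambda>n. \<Sum>k<(\<Sum>j<n. 2 ^ l j). x k) \<longlonglongrightarrow> suminf x"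
    using LIMSEQ_subseq_LIMSEQ[OF summable_LIMSEQ[OF assms(2)] strict_mono_offset[of l]]
    by (simp add: o_def)
  then have "suminf x = suminf y"
    unfolding sum_grouped[OF assms(1)] using summable_LIMSEQ[OF assms(3)] LIMSEQ_unique by blast
  then show ?thesis
    by (simp add: suminf_minus_initial_segment assms sum_grouped[OF assms(1)])
qed

section \<open>Mergings are exactly the semi-fast representations\<close>

lemma fast_imp_decreasing:
  fixes y :: "nat \<Rightarrow> real"
  assumes "\<And>n. 0 \<le> y n" "summable y" "(\<Sum>i. y (i + Suc n)) < y n"
  shows "y (Suc n) < y n"
proof -
  have "sum (\<lambda>i. y (i + Suc n)) {0} \<le> (\<Sum>i. y (i + Suc n))"
    by (intro sum_le_suminf summable_ignore_initial_segment assms) auto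
  then show ?thesis
    using assms(3) by simp
qed

text \<open>By \<open>l\<close> positive exponents count down to 0 while \<open>y\<close> halves.
  Hence each value of \<open>x\<close> recurs at an offset \<open>p m\<close> with
  \<open>l m = 0\<close>. All smaller terms come later, and their sum is at most the tail of
  \<open>y\<close> after \<open>m\<close>, which \<open>fast\<close> controls.\<close>

lemma grouped_semi_fast_representation:
  fixes x y :: "nat \<Rightarrow> real"
  assumes y: "\<And>n. 0 < y n" "summable y" and fast: "\<And>n. (\<Sum>i. y (i + Suc n)) < y n"
    and gr: "grouped x y l"
    and l: "\<And>n. 0 < l n \<Longrightarrow> l n = Suc (l (Suc n)) \<and> y n = 2 * y (Suc n)"
  shows "x \<in> semi_fast_representations (achievement_set y)"
proof -
  have y0: "\<And>n. 0 \<le> y n"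
    using y(1) by (auto intro: less_imp_le)
  define p where "p n = (\<Sum>k<n. (2::nat) ^ l k)" for n
  define v where "v n = y n / 2 ^ l n" for n
  have p_Suc: "p (Suc n) = p n + 2 ^ l n" for n
    by (simp add: p_def)
  have xv: "x (p n + i) = v n" if "i < 2 ^ l n" for n i
    using groupedD[OF gr that] by (simp add: p_def v_def)
  have index: "\<exists>n i. k = p n + i \<and> i < 2 ^ l n" for k
    unfolding p_def by (rule block_index[of "\<lambda>n. 2 ^ l n" k]) auto
  have pos: "0 < x k" for k
    using index[of k] xv y(1) by (auto simp: v_def)
  have v_Suc: "v (Suc n) \<le> v n" for n
  proof (cases "l n = 0")
    case True
    have "v (Suc n) \<le> y (Suc n)"
      using y0[of "Suc n"] by (simp add: v_def divide_le_eq mult_le_cancel_left1)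
    also have "\<dots> \<le> y n"
      using fast_imp_decreasing[OF y0 y(2) fast] by (simp add: less_imp_le)
    finally show ?thesis
      using True by (simp add: v_def)
  next
    case False
    then have "l n = Suc (l (Suc n))" "y n = 2 * y (Suc n)"
      using l by auto
    then show ?thesis
      by (simp add: v_def)
  qed
  have dec: "decseq x"
  proof (rule decseq_SucI)
    fix k
    obtain n i where k: "k = p n + i" "i < 2 ^ l n"
      using index by blast
    show "x (Suc k) \<le> x k"
    proof (cases "Suc i < 2 ^ l n")
      case True
      then show ?thesis
        using xv[of "Suc i" n] xv[of i n] k by simp
    next
      case False
      then have "Suc k = p (Suc n) + 0"
        using k by (simp add: p_Suc)
      then show ?thesis
        using xv[of 0 "Suc n"] xv[of i n] k v_Suc[of n] by simp
    qed
  qed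
  have "summable x"
  proof (rule summableI_nonneg_bounded)
    fix m
    have "m \<le> p m"
      unfolding p_def by (rule strict_mono_imp_increasing[OF strict_mono_offset])
    then have "(\<Sum>k<m. x k) \<le> (\<Sum>k<p m. x k)"
      using pos by (intro sum_mono2) (auto intro: less_imp_le)
    also have "\<dots> = (\<Sum>k<m. y k)"
      unfolding p_def by (rule sum_grouped[OF gr])
    also have "\<dots> \<le> suminf y"
      using y0 y(2) by (intro sum_le_suminf) auto
    finally show "(\<Sum>k<m. x k) \<le> suminf y" .
  qed (use pos in \<open>auto intro: less_imp_le\<close>)
  have x0: "\<And>n. 0 \<le> x n"
    using pos by (auto intro: less_imp_le)
  \<comment> \<open>Each step of the countdown halves both \<open>y n\<close> and
    \<open>2 ^ l n\<close>, so \<open>v\<close> stays constant.\<close>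
  have run_end: "\<exists>m. l m = 0 \<and> y m = v n" for n
  proof (induction "l n" arbitrary: n)
    case 0
    then show ?case
      by (intro exI[of _ n]) (simp add: v_def)
  next
    case (Suc d)
    have *: "l n = Suc (l (Suc n))" "y n = 2 * y (Suc n)"
      using l[of n] Suc.hyps(2) by simp_all
    then obtain m where "l m = 0" "y m = v (Suc n)"
      using Suc.hyps by force
    moreover have "v (Suc n) = v n"
      using * by (simp add: v_def)
    ultimately show ?case
      by auto
  qed
  have "semi_fast_convergent x"
    unfolding semi_fast_convergent_def
  proof
    fix k
    obtain n i where k: "k = p n + i" "i < 2 ^ l n"
      using index by blast
    obtain m where m: "l m = 0" "y m = v n"
      using run_end by blast
    have xk: "x (p m) = x k"
      using xv[of 0 m] xv[of i n] k m by (simp add: v_def)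
    have "x summable_on UNIV"
      using summable_on_UNIV_nonneg_real_iff[OF x0] \<open>summable x\<close> by simp
    then have summ: "x summable_on A" for A
      by (rule summable_on_subset_banach) simp
    have "infsum x {j. x j < x k} \<le> infsum x {p m<..}"
    proof (rule infsum_mono_neutral[OF summ summ])
      fix j assume "j \<in> {j. x j < x k} - {p m<..}"
      then have "x j < x (p m)" "j \<le> p m"
        using xk by auto
      then show "x j \<le> 0"
        using decseqD[OF dec, of j "p m"] by simp
    qed (use x0 in auto)
    \<comment> \<open>As \<open>l m = 0\<close>, the term \<open>y m\<close> occupies a single
      position and \<open>p (Suc m) = Suc (p m)\<close>.\<close>
    also have "\<dots> = (\<Sum>i. x (i + p (Suc m)))"
      using infsum_greaterThan_eq_suminf[OF x0 \<open>summable x\<close>] m by (simp add: p_Suc)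
    also have "\<dots> = (\<Sum>i. y (i + Suc m))"
      unfolding p_def by (rule suminf_grouped[OF gr \<open>summable x\<close> y(2)])
    also have "\<dots> < y m"
      by (rule fast)
    also have "y m = x k"
      using xv[of i n] k m by simp
    finally show "infsum x {j. x j < x k} < x k" .
  qed
  moreover have "achievement_set x = achievement_set y"
    by (rule achievement_set_grouped[OF x0 \<open>summable x\<close> y0 y(2) gr])
  ultimately show ?thesis
    using pos dec \<open>summable x\<close> by (simp add: semi_fast_representations_def is_representation_def)
qed

text \<open>Iterating \<open>semi_fast_leading_block\<close> removes \<open>h n + 1\<close> entries
  of \<open>x\<close> for each \<open>y n\<close>. The \<open>h n\<close> copies left over, if any,
  constitute the next leading block, which forces \<open>h n + 1\<close> to be a power of 2.\<close>

lemma semi_fast_imp_grouped: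
  fixes x y :: "nat \<Rightarrow> real"
  assumes y: "\<And>n. 0 < y n" "summable y" and fast: "\<And>n. (\<Sum>i. y (i + Suc n)) < y n"
    and x_rep: "x \<in> semi_fast_representations (achievement_set y)"
  obtains l where "grouped x y l" "\<And>n. 0 < l n \<Longrightarrow> l n = Suc (l (Suc n)) \<and> y n = 2 * y (Suc n)"
proof -
  have x: "\<And>n. 0 < x n" "summable x" "decseq x" and eq: "achievement_set x = achievement_set y"
    and sfc: "semi_fast_convergent x"
    using x_rep by (auto simp: semi_fast_representations_def is_representation_def)
  have x0: "\<And>n. 0 \<le> x n"
    using x(1) by (auto intro: less_imp_le)
  \<comment> \<open>At a strict descent the smaller terms are precisely the later ones.\<close>
  have sf: "(\<Sum>i. x (i + Suc n)) < x n" if "x (Suc n) < x n" for n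
  proof -
    have "{k. x k < x n} = {n<..}"
    proof (intro set_eqI iffI)
      fix k assume "k \<in> {k. x k < x n}"
      then show "k \<in> {n<..}"
        using decseqD[OF x(3), of k n] by (cases "k \<le> n") auto
    next
      fix k assume "k \<in> {n<..}"
      then have "x k \<le> x (Suc n)"
        using decseqD[OF x(3), of "Suc n" k] by simp
      then show "k \<in> {k. x k < x n}"
        using that by simp
    qed
    then show ?thesis
      using sfc infsum_greaterThan_eq_suminf[OF x0 x(2)] unfolding semi_fast_convergent_def by metis
  qed
  define P where "P n q \<longleftrightarrow> achievement_set (\<lambda>i. x (i + q)) = achievement_set (\<lambda>i. y (i + n))" for n q
  define B where "B n q h \<longleftrightarrow> y n = real (Suc h) * x q \<and> (\<forall>i<2 * h + 1. x (i + q) = x q) \<and>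
      x (2 * h + 1 + q) < x q" for n q h
  have step: "\<exists>h. B n q h \<and> P (Suc n) (q + Suc h)" if "P n q" for n q
  proof -
    have sm: "summable (\<lambda>i. x (i + q))" "summable (\<lambda>i. y (i + n))"
      using x(2) y(2) by (auto intro: summable_ignore_initial_segment)
    have sf': "(\<Sum>i. x (i + Suc k + q)) < x (k + q)" if "x (Suc k + q) < x (k + q)" for k
      using sf[of "k + q"] that by (simp add: ac_simps)
    have dec: "decseq (\<lambda>i. x (i + q))"
      using x(3) by (simp add: decseq_def)
    have fast': "(\<Sum>i. y (i + Suc k + n)) < y (k + n)" for k
      using fast[of "k + n"] by (simp add: ac_simps)
    show ?thesis
      using semi_fast_leading_block[where x = "\<lambda>i. x (i + q)" and y = "\<lambda>i. y (i + n)",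
          OF x(1) sm(1) dec sf' y(1) sm(2) fast'] that
      unfolding P_def B_def by (simp add: ac_simps)
  qed
  have "\<exists>q. \<forall>n. (P n (q n) \<and> (n = 0 \<longrightarrow> q n = 0)) \<and> (\<exists>h. B n (q n) h \<and> q (Suc n) = q n + Suc h)"
  proof (rule dependent_nat_choice)
    show "\<exists>q. P 0 q \<and> (0 = (0::nat) \<longrightarrow> q = 0)"
      by (auto simp: P_def eq)
  next
    fix q n assume "P n q \<and> (n = 0 \<longrightarrow> q = 0)"
    then obtain h where "B n q h" "P (Suc n) (q + Suc h)"
      using step by blast
    then show "\<exists>q'. (P (Suc n) q' \<and> (Suc n = 0 \<longrightarrow> q' = 0)) \<and> (\<exists>h. B n q h \<and> q' = q + Suc h)"
      by blast
  qed
  then obtain q where q: "\<And>n. n = 0 \<longrightarrow> q n = 0" "\<And>n. \<exists>h. B n (q n) h \<and> q (Suc n) = q n + Suc h"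
    by blast
  have q0: "q 0 = 0"
    using q(1) by blast
  obtain h where h: "\<And>n. B n (q n) (h n)" "\<And>n. q (Suc n) = q n + Suc (h n)"
    using q(2) by metis
  have y_eq: "y n = real (Suc (h n)) * x (q n)" for n
    using h(1)[of n] by (simp add: B_def)
  have blk: "x (i + q n) = x (q n)" if "i < 2 * h n + 1" for i n
    using h(1)[of n] that by (simp add: B_def)
  have drop: "x (2 * h n + 1 + q n) < x (q n)" for n
    using h(1)[of n] by (simp add: B_def)
  \<comment> \<open>If the next block were shorter or longer than the leftover copies,
    \<open>drop\<close> at one of the two blocks would be violated.\<close>
  have h_Suc: "h n = 2 * h (Suc n) + 1" "x (q (Suc n)) = x (q n)" if "0 < h n" for n
  proof -
    show *: "x (q (Suc n)) = x (q n)"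
      using blk[of "Suc (h n)" n] that h(2)[of n] by (simp add: add.commute)
    have "\<not> 2 * h (Suc n) + 1 < h n"
    proof
      assume "2 * h (Suc n) + 1 < h n"
      then have "x (2 * h (Suc n) + 1 + Suc (h n) + q n) = x (q n)"
        by (intro blk) simp
      then show False
        using drop[of "Suc n"] h(2)[of n] * by (simp add: ac_simps)
    qed
    moreover have "\<not> h n < 2 * h (Suc n) + 1"
    proof
      assume "h n < 2 * h (Suc n) + 1"
      then have "x (h n + q (Suc n)) = x (q (Suc n))"
        by (rule blk)
      then show False
        using drop[of n] h(2)[of n] * by (simp add: mult_2_right ac_simps)
    qed
    ultimately show "h n = 2 * h (Suc n) + 1"
      by linarith
  qed
  have "\<exists>d. Suc (h n) = 2 ^ d" for n
  proof (induction "h n" arbitrary: n rule: less_induct)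
    case less
    show ?case
    proof (cases "h n = 0")
      case True
      then show ?thesis
        by (intro exI[of _ 0]) simp
    next
      case False
      then have "h n = 2 * h (Suc n) + 1"
        using h_Suc by simp
      moreover from this obtain d where "Suc (h (Suc n)) = 2 ^ d"
        using less[of "Suc n"] by auto
      ultimately have "Suc (h n) = 2 ^ Suc d"
        by simp
      then show ?thesis ..
    qed
  qed
  then obtain l where l: "\<And>n. Suc (h n) = 2 ^ l n"
    by metis
  have q_eq: "q n = (\<Sum>k<n. 2 ^ l k)" for n
  proof (induction n)
    case (Suc n)
    then show ?case
      using h(2)[of n] l[of n] by simp
  qed (simp add: q0)
  have x_eq: "x (q n) = y n / 2 ^ l n" for n
  proof -
    have "real (Suc (h n)) = 2 ^ l n"
      by (simp only: l of_nat_power of_nat_numeral)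
    then show ?thesis
      using y_eq[of n] by simp
  qed
  show ?thesis
  proof
    show "grouped x y l"
      unfolding grouped_def
    proof (intro allI impI)
      fix n i :: nat assume "i < 2 ^ Suc (l n) - 1"
      then have "i < 2 * h n + 1"
        using l[of n] by simp
      then show "x ((\<Sum>k<n. 2 ^ l k) + i) = y n / 2 ^ l n"
        using blk[of i n] x_eq[of n] by (simp add: q_eq add.commute)
    qed
    fix n assume "0 < l n"
    have "0 < h n"
    proof (rule ccontr)
      assume "\<not> 0 < h n"
      then have "2 ^ l n = (1::nat)"
        using l[of n] by simp
      with \<open>0 < l n\<close> show False by simp
    qed
    note * = h_Suc[OF this]
    have "(2::nat) ^ l n = 2 ^ Suc (l (Suc n))"
      using * l[of n] l[of "Suc n"] by simp
    then have "l n = Suc (l (Suc n))"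
      by (subst (asm) power_inject_exp) auto
    moreover have "y n = 2 * y (Suc n)"
      using y_eq[of n] y_eq[of "Suc n"] * by (simp add: algebra_simps)
    ultimately show "l n = Suc (l (Suc n)) \<and> y n = 2 * y (Suc n)"
      by blast
  qed
qed

subsection \<open>Counting the semi-fast representations\<close>

text \<open>The minimum exists for the sets of interest: by \<open>fast_not_halving\<close>, a set
  of indices at which \<open>y\<close> halves omits arbitrarily large numbers.\<close>

definition run_length :: "nat set \<Rightarrow> nat \<Rightarrow> nat" where
  "run_length T n = (LEAST m. n + m \<notin> T)"

text \<open>
  \<open>n \<in> T\<close> means that \<open>y n\<close> and \<open>y (Suc n)\<close> belong to the same run. The blocks passed to
  \<open>block_seq\<close> do not have distinct values: the terms of one run contribute adjacent blocks with
  a common value.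
\<close>

definition merge_runs :: "(nat \<Rightarrow> real) \<Rightarrow> nat set \<Rightarrow> nat \<Rightarrow> real" where
  "merge_runs y T = block_seq (\<lambda>n. y n / 2 ^ run_length T n) (\<lambda>n. 2 ^ run_length T n)"

lemma run_length_outside: "n \<notin> T \<Longrightarrow> run_length T n = 0"
  unfolding run_length_def by (rule Least_equality) auto

lemma run_length_Suc:
  assumes "n \<in> T" "m \<ge> n" "m \<notin> T"
  shows "run_length T n = Suc (run_length T (Suc n))"
proof -
  have "n + (m - n) \<notin> T" "n + 0 \<in> T"
    using assms by auto
  then have "(LEAST m. n + m \<notin> T) = Suc (LEAST m. n + Suc m \<notin> T)"
    by (intro Least_Suc) auto
  then show ?thesis
    by (simp add: run_length_def)
qed

lemma grouped_merge_runs: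
  assumes T: "\<And>n. n \<in> T \<Longrightarrow> y n = 2 * y (Suc n)" and ex: "\<And>n. \<exists>m\<ge>n. m \<notin> T"
  shows "grouped (merge_runs y T) y (run_length T)"
proof -
  let ?l = "run_length T"
  let ?p = "\<lambda>n. \<Sum>k<n. (2::nat) ^ ?l k"
  have "merge_runs y T (?p n + i) = y n / 2 ^ ?l n" if "i < 2 ^ Suc (?l n) - 1" for n i
    using that
  proof (induction "?l n" arbitrary: n i)
    case 0
    then have "i < 2 ^ ?l n"
      by simp
    then show ?case
      unfolding merge_runs_def by (rule block_seq_eq)
  next
    case (Suc d)
    show ?case
    proof (cases "i < 2 ^ ?l n")
      case True
      then show ?thesis
        unfolding merge_runs_def by (rule block_seq_eq)
    next
      case False
      have "n \<in> T"
        using Suc.hyps(2) run_length_outside by fastforce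
      then have l_n: "?l n = Suc (?l (Suc n))"
        using ex[of n] run_length_Suc by blast
      \<comment> \<open>The block of \<open>n\<close> supplies \<open>2 ^ ?l n\<close> entries. The
        missing \<open>2 ^ ?l n - 1\<close> are those guaranteed at the next offset, where the value
        is the same.\<close>
      have "merge_runs y T (?p (Suc n) + (i - 2 ^ ?l n)) = y (Suc n) / 2 ^ ?l (Suc n)"
      proof (rule Suc.hyps(1))
        show "d = ?l (Suc n)"
          using Suc.hyps(2) l_n by simp
        show "i - 2 ^ ?l n < 2 ^ Suc (?l (Suc n)) - 1"
          using Suc.prems l_n False by simp
      qed
      moreover have "?p (Suc n) + (i - 2 ^ ?l n) = ?p n + i"
        using False by simp
      moreover have "y n / 2 ^ ?l n = y (Suc n) / 2 ^ ?l (Suc n)"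
        using T[OF \<open>n \<in> T\<close>] l_n by simp
      ultimately show ?thesis
        by simp
    qed
  qed
  then show ?thesis
    by (simp add: grouped_def)
qed

text \<open>Positive exponents count down by one to 0, so each is the distance to the first index
  outside the support.\<close>

lemma run_length_support:
  fixes l :: "nat \<Rightarrow> nat"
  assumes "\<And>n. 0 < l n \<Longrightarrow> l n = Suc (l (Suc n))"
  shows "run_length {n. 0 < l n} = l"
proof
  fix n
  have ex: "\<exists>m\<ge>n. l m = 0" for n
  proof (induction "l n" arbitrary: n)
    case (Suc d)
    then have "d = l (Suc n)"
      using assms[of n] by simp
    then obtain m where "m \<ge> Suc n" "l m = 0"
      using Suc.hyps(1) by blast
    then show ?case
      by (auto intro: exI[of _ m])
  qed auto
  show "run_length {n. 0 < l n} n = l n"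
  proof (induction "l n" arbitrary: n)
    case 0
    then show ?case
      by (simp add: run_length_outside)
  next
    case (Suc d)
    then have "0 < l n" by simp
    then have *: "l n = Suc (l (Suc n))"
      by (rule assms)
    obtain m where m: "m \<ge> n" "l m = 0"
      using ex by blast
    have "run_length {n. 0 < l n} n = Suc (run_length {n. 0 < l n} (Suc n))"
      by (rule run_length_Suc[OF _ m(1)]) (use \<open>0 < l n\<close> m in auto)
    then show ?case
      using Suc * by simp
  qed
qed

text \<open>The exponents of a merging are unique and their support is \<open>T\<close>, whence
  injectivity. Conversely, the exponents of any semi-fast representation are the run lengths of
  their support.\<close>

lemma bij_betw_merge_runs:
  fixes y :: "nat \<Rightarrow> real"
  assumes y: "\<And>n. 0 < y n" "summable y" and fast: "\<And>n. (\<Sum>i. y (i + Suc n)) < y n"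
  shows "bij_betw (merge_runs y) (Pow {n. y n = 2 * y (Suc n)})
    (semi_fast_representations (achievement_set y))"
proof -
  have ex: "\<exists>m\<ge>n. m \<notin> T" if "T \<subseteq> {n. y n = 2 * y (Suc n)}" for T n
    using fast_not_halving[OF y(2) fast[of n]] that by blast
  have gr: "grouped (merge_runs y T) y (run_length T)" if "T \<subseteq> {n. y n = 2 * y (Suc n)}" for T
    by (rule grouped_merge_runs) (use that ex in auto)
  have supp: "0 < run_length T n \<longleftrightarrow> n \<in> T" if "T \<subseteq> {n. y n = 2 * y (Suc n)}" for T n
    using run_length_outside[of n T] run_length_Suc[of n T] ex[OF that, of n] by (cases "n \<in> T") auto
  show ?thesis
  proof (intro bij_betw_imageI inj_onI)
    fix S T assume "S \<in> Pow {n. y n = 2 * y (Suc n)}" "T \<in> Pow {n. y n = 2 * y (Suc n)}"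
      and eq: "merge_runs y S = merge_runs y T"
    then have sub: "S \<subseteq> {n. y n = 2 * y (Suc n)}" "T \<subseteq> {n. y n = 2 * y (Suc n)}"
      by auto
    have "run_length S = run_length T"
      using grouped_exponent_unique[OF gr[OF sub(1)] _ y(1)] gr[OF sub(2)] eq by simp
    then show "S = T"
      using supp[OF sub(1)] supp[OF sub(2)] by auto
  next
    show "merge_runs y ` Pow {n. y n = 2 * y (Suc n)} = semi_fast_representations (achievement_set y)"
    proof (intro equalityI subsetI)
      fix x assume "x \<in> merge_runs y ` Pow {n. y n = 2 * y (Suc n)}"
      then obtain T where T: "T \<subseteq> {n. y n = 2 * y (Suc n)}" and x: "x = merge_runs y T"
        by auto
      show "x \<in> semi_fast_representations (achievement_set y)"
        unfolding x
      proof (rule grouped_semi_fast_representation[OF y fast gr[OF T]])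
        fix n assume "0 < run_length T n"
        then have "n \<in> T"
          using supp[OF T] by simp
        then show "run_length T n = Suc (run_length T (Suc n)) \<and> y n = 2 * y (Suc n)"
          using run_length_Suc ex[OF T, of n] T by blast
      qed
    next
      fix x assume "x \<in> semi_fast_representations (achievement_set y)"
      then obtain l where l: "grouped x y l" "\<And>n. 0 < l n \<Longrightarrow> l n = Suc (l (Suc n)) \<and> y n = 2 * y (Suc n)"
        using semi_fast_imp_grouped[OF y fast] by blast
      have sub: "{n. 0 < l n} \<subseteq> {n. y n = 2 * y (Suc n)}"
        using l(2) by blast
      have "run_length {n. 0 < l n} = l"
        using run_length_support l(2) by blast
      then have "x = merge_runs y {n. 0 < l n}"
        using grouped_unique[OF l(1)] gr[OF sub] by simp
      then show "x \<in> merge_runs y ` Pow {n. y n = 2 * y (Suc n)}"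
        using sub by blast
    qed
  qed
qed

section \<open>The fast convergent sequence of the theorem and the count\<close>

text \<open>The nonnegative numbers \<open>y i - 2 * y (Suc i)\<close> from \<open>i = n\<close> on
  sum to \<open>y n\<close> minus the tail after \<open>n\<close>, and \<open>strict\<close> makes
  one of them positive.\<close>

lemma fast_of_halving:
  fixes y :: "nat \<Rightarrow> real"
  assumes pos: "\<And>n. 0 < y n" and half: "\<And>n. 2 * y (Suc n) \<le> y n"
    and strict: "\<And>n. \<exists>m\<ge>n. 2 * y (Suc m) < y m"
  shows "summable y" and "(\<Sum>i. y (i + Suc n)) < y n"
proof -
  have "(\<Sum>i<n. y i) \<le> 2 * y 0 - 2 * y n" for n
  proof (induction n)
    case (Suc n)
    then show ?case
      using half[of n] by simp
  qed simp
  then have "(\<Sum>i<n. y i) \<le> 2 * y 0" for n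
    using pos[of n] by (smt (verit))
  then show summ: "summable y"
    using pos by (intro summableI_nonneg_bounded) (auto intro: less_imp_le)
  have sm: "summable (\<lambda>i. y (i + k))" for k
    using summ by (rule summable_ignore_initial_segment)
  obtain m where m: "m \<ge> n" "2 * y (Suc m) < y m"
    using strict by blast
  have "0 < (\<Sum>i. y (i + n) - 2 * y (i + Suc n))"
  proof (rule suminf_pos2)
    show "summable (\<lambda>i. y (i + n) - 2 * y (i + Suc n))"
      by (intro summable_diff summable_mult sm)
    show "0 \<le> y (i + n) - 2 * y (i + Suc n)" for i
      using half[of "i + n"] by simp
    show "0 < y (m - n + n) - 2 * y (m - n + Suc n)"
      using m by simp
  qed
  also have "\<dots> = (\<Sum>i. y (i + n)) - 2 * (\<Sum>i. y (i + Suc n))"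
    by (simp only: suminf_diff[OF sm summable_mult[OF sm], symmetric] suminf_mult[OF sm])
  also have "(\<Sum>i. y (i + n)) = y n + (\<Sum>i. y (i + Suc n))"
    using suminf_split_head[OF sm, of n] by simp
  finally show "(\<Sum>i. y (i + Suc n)) < y n"
    by simp
qed

lemma infinite_Pow_eqpoll_reals:
  fixes R :: "nat set"
  assumes "infinite R"
  shows "Pow R \<approx> (UNIV :: real set)"
proof -
  obtain f where "bij_betw f (UNIV :: nat set) R"
    using countable_infiniteE'[OF countableI_type assms] by blast
  then have "bij_betw (image f) (Pow UNIV) (Pow R)"
    by (rule bij_betw_Pow)
  then have "(UNIV :: nat set set) \<approx> Pow R"
    unfolding eqpoll_def by (auto simp: Pow_UNIV)
  then show ?thesis
    using nat_sets_eqpoll_reals eqpoll_sym eqpoll_trans by blast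
qed

theorem corollary2p9:
  fixes M :: "nat \<Rightarrow> nat" and \<alpha> :: "nat \<Rightarrow> real" and E :: "real set"
  assumes "\<And>i. 0 < M i"
    and "\<And>i. 0 < \<alpha> i"
    and "\<And>i. \<alpha> i > 2 ^ M (Suc i) * \<alpha> (Suc i)"
    and "E = achievement_set (block_seq \<alpha> (\<lambda>i. 2 ^ M i - 1))"
  shows "central_cantor_set E \<and>
    (semi_fast_representations E \<approx> (UNIV :: real set) \<longleftrightarrow> infinite {i. M i > 1}) \<and>
    (finite {i. M i \<noteq> 1} \<longrightarrow>
       finite (semi_fast_representations E) \<and>
       (\<lambda>i. 2 ^ (M i - 1)) has_prod card (semi_fast_representations E))"
proof -
  \<comment> \<open>Block \<open>k\<close> of \<open>y\<close> starts at \<open>s k\<close>,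
    position \<open>n\<close> lies in block \<open>blk n\<close>, and \<open>u n\<close> positions
    of that block follow it. So block \<open>k\<close> reads
    \<open>2 ^ (M k - 1) * \<alpha> k, ..., 2 * \<alpha> k, \<alpha> k\<close>.\<close>
  define s where "s k = (\<Sum>i<k. M i)" for k
  define blk where "blk n = (LEAST k. n < (\<Sum>i\<le>k. M i))" for n
  define u where "u n = s (Suc (blk n)) - Suc n" for n
  define y where "y n = 2 ^ u n * \<alpha> (blk n)" for n
  define x where "x = block_seq \<alpha> (\<lambda>i. 2 ^ M i - 1)"
  \<comment> \<open>With \<open>real\<close> in place of \<open>\<alpha>\<close>, the value of
    \<open>block_seq\<close> is the block number itself.\<close>
  have blk_eq: "blk (s k + j) = k" if "j < M k" for k j
    using block_seq_eq[of j M k real] that by (simp add: block_seq_def blk_def s_def)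
  have u_eq: "u (s k + j) = M k - Suc j" if "j < M k" for k j
    using blk_eq[OF that] by (simp add: u_def s_def)
  have y_eq: "y (s k + j) = 2 ^ (M k - Suc j) * \<alpha> k" if "j < M k" for k j
    using blk_eq[OF that] u_eq[OF that] by (simp add: y_def)
  have index: "\<exists>k j. n = s k + j \<and> j < M k" for n
    unfolding s_def by (rule block_index[of M n, OF assms(1)]) blast
  have s_Suc: "s (Suc k) = s k + M k" for k
    by (simp add: s_def)
  have y_pos: "0 < y n" for n
    using assms(2) by (simp add: y_def)
  have inside: "y (s k + j) = 2 * y (Suc (s k + j))" if "Suc j < M k" for k j
  proof -
    have "M k - Suc j = Suc (M k - Suc (Suc j))"
      using that by simp
    then show ?thesis
      using y_eq[of j k] y_eq[of "Suc j" k] that by simp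
  qed
  have boundary: "2 * y (Suc (s k + j)) < y (s k + j)" if "Suc j = M k" for k j
  proof -
    have "Suc (s k + j) = s (Suc k) + 0"
      using that by (simp add: s_Suc)
    then have "2 * y (Suc (s k + j)) = 2 * (2 ^ (M (Suc k) - 1) * \<alpha> (Suc k))"
      using y_eq[of 0 "Suc k"] assms(1)[of "Suc k"] by simp
    also have "\<dots> = 2 ^ Suc (M (Suc k) - 1) * \<alpha> (Suc k)"
      by simp
    also have "\<dots> = 2 ^ M (Suc k) * \<alpha> (Suc k)"
      using assms(1)[of "Suc k"] by simp
    also have "\<dots> < \<alpha> k"
      by (rule assms(3))
    also have "\<dots> = y (s k + j)"
      using y_eq[of j k] that by simp
    finally show ?thesis .
  qed
  have half: "2 * y (Suc n) \<le> y n" for n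
  proof -
    obtain k j where n: "n = s k + j" "j < M k"
      using index by blast
    then show ?thesis
      using inside[of j k] boundary[of j k] by (cases "Suc j = M k") auto
  qed
  have strict: "\<exists>m\<ge>n. 2 * y (Suc m) < y m" for n
  proof -
    obtain k j where "n = s k + j" "j < M k"
      using index by blast
    then show ?thesis
      using boundary[of "M k - 1" k] by (intro exI[of _ "s k + (M k - 1)"]) auto
  qed
  note summ = fast_of_halving(1)[OF y_pos half strict]
  note fast = fast_of_halving(2)[OF y_pos half strict]
  \<comment> \<open>The exponents in block \<open>k\<close> are
    \<open>M k - 1, M k - 2, ...\<close>; the first \<open>j\<close> powers of 2 add up to
    \<open>2 ^ M k - 2 ^ (M k - j)\<close>.\<close>
  have offset: "(\<Sum>m<s k + j. (2::nat) ^ u m) = (\<Sum>i<k. 2 ^ M i - 1) + (2 ^ M k - 2 ^ (M k - j))"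
    if "j \<le> M k" for k j
    using that
  proof (induction k arbitrary: j)
    case 0
    then show ?case
    proof (induction j)
      case (Suc j)
      then have *: "M 0 - j = Suc (M 0 - Suc j)"
        by simp
      have "(2::nat) ^ (M 0 - j) \<le> 2 ^ M 0"
        by (intro power_increasing) auto
      then show ?case
        using Suc u_eq[of j 0] by (simp add: * s_def)
    qed (simp add: s_def)
  next
    case (Suc k)
    from Suc.prems show ?case
    proof (induction j)
      case 0
      then show ?case
        using Suc.IH[of "M k"] by (simp add: s_Suc)
    next
      case (Suc j)
      then have *: "M (Suc k) - j = Suc (M (Suc k) - Suc j)"
        by simp
      have "(2::nat) ^ (M (Suc k) - j) \<le> 2 ^ M (Suc k)"
        by (intro power_increasing) auto
      then show ?case
        using Suc u_eq[of j "Suc k"] by (simp add: *)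
    qed
  qed
  \<comment> \<open>The given sequence is itself a merging of \<open>y\<close>: at the offset of
    \<open>s k + j\<close>, block \<open>k\<close> still has \<open>2 ^ (M k - j) - 1\<close> copies
    of \<open>\<alpha> k\<close>. This identifies \<open>E\<close>.\<close>
  have "grouped x y u"
    unfolding grouped_def
  proof (intro allI impI)
    fix n i :: nat assume i: "i < 2 ^ Suc (u n) - 1"
    obtain k j where n: "n = s k + j" "j < M k"
      using index by blast
    have "Suc (u n) = M k - j"
      using u_eq[OF n(2)] n by simp
    then have i': "i < 2 ^ (M k - j) - 1"
      using i by simp
    have "(2::nat) ^ (M k - j) \<le> 2 ^ M k"
      by (intro power_increasing) auto
    then have "(2 ^ M k - 2 ^ (M k - j)) + i < 2 ^ M k - 1"
      using i' by linarith
    from block_seq_eq[where N = "\<lambda>i. 2 ^ M i - 1" and k = k, OF this] have "x ((\<Sum>m<n. 2 ^ u m) + i) = \<alpha> k"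
      using offset[of j k] n(2) unfolding n(1) x_def by (simp only: add.assoc less_imp_le)
    then show "x ((\<Sum>m<n. 2 ^ u m) + i) = y n / 2 ^ u n"
      using blk_eq[OF n(2)] n(1) by (simp add: y_def)
  qed
  moreover have "0 < u n \<Longrightarrow> u n = Suc (u (Suc n)) \<and> y n = 2 * y (Suc n)" for n
  proof -
    assume "0 < u n"
    obtain k j where n: "n = s k + j" "j < M k"
      using index by blast
    then have "Suc j < M k"
      using u_eq[OF n(2)] \<open>0 < u n\<close> by simp
    then show ?thesis
      using n inside[of j k] u_eq[of j k] u_eq[of "Suc j" k] by simp
  qed
  ultimately have "x \<in> semi_fast_representations (achievement_set y)"
    by (rule grouped_semi_fast_representation[OF y_pos summ fast])
  then have E: "E = achievement_set y"
    using assms(4) by (simp add: x_def semi_fast_representations_def is_representation_def)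
  have y0: "\<And>n. 0 \<le> y n"
    using y_pos by (auto intro: less_imp_le)
  have "is_representation y E"
    unfolding is_representation_def E
    using y_pos summ fast_imp_decreasing[OF y0 summ fast]
    by (auto intro!: decseq_SucI less_imp_le)
  moreover have "fast_convergent y"
    unfolding fast_convergent_def infsum_greaterThan_eq_suminf[OF y0 summ] using fast by blast
  ultimately have central: "central_cantor_set E"
    unfolding central_cantor_set_def by blast

  define R where "R = {n. y n = 2 * y (Suc n)}"
  have bij: "bij_betw (merge_runs y) (Pow R) (semi_fast_representations E)"
    unfolding R_def E by (rule bij_betw_merge_runs[OF y_pos summ fast])
  define K where "K = {i. M i \<noteq> 1}"
  have K: "{i. M i > 1} = K"
  proof -
    have "M i > 1 \<longleftrightarrow> M i \<noteq> 1" for i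
      using assms(1)[of i] by linarith
    then show ?thesis
      by (simp add: K_def)
  qed
  \<comment> \<open>The pairs encode the positions that are not last in their block; blocks outside
    \<open>K\<close> have none.\<close>
  define D where "D = Sigma K (\<lambda>k. {..<M k - 1})"
  have R_eq: "R = (\<lambda>(k, j). s k + j) ` D"
  proof (intro equalityI subsetI)
    fix n assume "n \<in> R"
    obtain k j where n: "n = s k + j" "j < M k"
      using index by blast
    then have "Suc j \<noteq> M k"
      using boundary[of j k] \<open>n \<in> R\<close> by (auto simp: R_def)
    then have "(k, j) \<in> D"
      using n by (auto simp: D_def K_def)
    then show "n \<in> (\<lambda>(k, j). s k + j) ` D"
      using n by (auto intro!: image_eqI[of _ _ "(k, j)"])
  next
    fix n assume "n \<in> (\<lambda>(k, j). s k + j) ` D"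
    then obtain k j where "n = s k + j" "j < M k - 1"
      by (auto simp: D_def)
    then show "n \<in> R"
      using inside[of j k] by (simp add: R_def)
  qed
  have inj: "inj_on (\<lambda>(k, j). s k + j) D"
  proof (rule inj_onI, clarify)
    fix k j k' j' assume D: "(k, j) \<in> D" "(k', j') \<in> D" and eq: "s k + j = s k' + j'"
    have "j < M k" "j' < M k'"
      using D by (auto simp: D_def)
    then have "k = k'"
      using blk_eq[of j k] blk_eq[of j' k'] eq by simp
    with eq show "k = k' \<and> j = j'"
      by simp
  qed
  have "finite D \<longleftrightarrow> finite K"
  proof
    assume "finite D"
    moreover have "K \<subseteq> fst ` D"
    proof
      fix i assume "i \<in> K"
      then have "(i, 0) \<in> D"
        using K by (auto simp: D_def)
      then show "i \<in> fst ` D"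
        by force
    qed
    ultimately show "finite K"
      using finite_surj by blast
  qed (simp add: D_def)
  then have fin: "finite R \<longleftrightarrow> finite K"
    unfolding R_eq using finite_image_iff[OF inj] by simp
  have "semi_fast_representations E \<approx> (UNIV :: real set) \<longleftrightarrow> infinite K"
  proof
    assume "infinite K"
    then have "Pow R \<approx> (UNIV :: real set)"
      using fin infinite_Pow_eqpoll_reals by blast
    moreover have "Pow R \<approx> semi_fast_representations E"
      using bij unfolding eqpoll_def by blast
    ultimately show "semi_fast_representations E \<approx> (UNIV :: real set)"
      using eqpoll_sym eqpoll_trans by blast
  next
    assume "semi_fast_representations E \<approx> (UNIV :: real set)"
    then have "infinite (semi_fast_representations E)"
      using eqpoll_finite_iff infinite_UNIV_char_0 by blast
    then have "infinite (Pow R)"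
      using bij_betw_finite[OF bij] by simp
    then show "infinite K"
      using fin by simp
  qed
  moreover have "finite (semi_fast_representations E) \<and>
      (\<lambda>i. 2 ^ (M i - 1)) has_prod card (semi_fast_representations E)" if "finite K"
  proof
    show "finite (semi_fast_representations E)"
      using bij_betw_finite[OF bij] fin that by simp
    have "card (semi_fast_representations E) = 2 ^ card R"
      using bij_betw_same_card[OF bij] fin that by (simp add: card_Pow)
    also have "card R = (\<Sum>k\<in>K. M k - 1)"
      unfolding R_eq card_image[OF inj] using that by (simp add: D_def)
    also have "2 ^ \<dots> = (\<Prod>k\<in>K. (2::nat) ^ (M k - 1))"
      by (rule power_sum)
    \<comment> \<open>Outside \<open>K\<close> the factors are \<open>2 ^ 0 = 1\<close>, so the
      infinite product is the finite one over \<open>K\<close>.\<close>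
    finally show "(\<lambda>i. 2 ^ (M i - 1)) has_prod card (semi_fast_representations E)"
      using has_prod_finite[OF that, of "\<lambda>i. (2::nat) ^ (M i - 1)"] by (simp add: K_def)
  qed
  ultimately show ?thesis
    using central unfolding K by (simp add: K_def)
qed

end
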